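(* Consider the system $x_{k+1}=A_kx_k+B_ku_k+w_k$, $y_k=C_kx_k+v_k$ with the Kalman filter $\hat x_{k+1}=A_k\hat x_k+B_ku_k+K_k(y_k-C_k\hat x_k)$, where the disturbances $w_k$ and the measurement noises $v_k$ are mutually independent zero-mean Gaussian white-noise processes with finite second moments. Then, for all $k\in\mathbb{N}$, $$\mathbb{E}[x_k-\hat x_k\mid\hat x_k]=0,\qquad \mathrm{cov}[x_k-\hat x_k\mid\hat x_k]=P_k .$$
   Context: System: $x_k\in\mathbb{R}^n$ is the state, $u_k\in\mathbb{R}^m$ the input, $y_k\in\mathbb{R}^{n_y}$ the measurement; $w_k$, $v_k$ and the matrices $A_k,B_k,C_k$ have compatible dimensions. Kalman filter (one-step predictor): $\hat x_k=\mathbb{E}[x_k\mid y_0,\dots,y_{k-1}]$, with gain $K_k=A_kP_kC_k^\top(C_kP_kC_k^\top+R_k)^{-1}$ and prediction error covariance matrix $P_k$ given by $P_{k+1}=A_kP_kA_k^\top+Q_k-A_kP_kC_k^\top(C_kP_kC_k^\top+R_k)^{-1}C_kP_kA_k^\top$, $P_0=\mathbb{E}[(x_0-\hat x_0)(x_0-\hat x_0)^\top]$, $Q_k=\mathbb{E}[w_kw_k^\top]$, $R_k=\mathbb{E}[v_kv_k^\top]$.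
   Formalization: The initial state x_0 is additionally assumed Gaussian and independent of all w_k, v_k (the covariance claim fails otherwise); x̂_0 = E[x_0], each u_k is a function of y_0,…,y_k, and C_k P_k C_k^T + R_k is assumed invertible. *)

theory Defs
  imports "HOL-Probability.Probability"
begin

definition rv_algebra :: "'a measure \<Rightarrow> ('a \<Rightarrow> 'b::topological_space) \<Rightarrow> 'a measure" where
  "rv_algebra M X = vimage_algebra (space M) X borel"

text \<open>The information available from the measurements up to and including time \<open>k\<close>. An input
  measurable with respect to it is a deterministic causal function of these measurements;
  inputs fixed in advance are the constant case.\<close>

definition history_algebra ::
    "'a measure \<Rightarrow> (nat \<Rightarrow> 'a \<Rightarrow> 'b::topological_space) \<Rightarrow> nat \<Rightarrow> 'a measure" where
  "history_algebra M Y k =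
     vimage_algebra (space M) (\<lambda>\<omega>. \<lambda>i\<in>{..k}. Y i \<omega>) (\<Pi>\<^sub>M i\<in>{..k}. borel)"

text \<open>A possibly degenerate Gaussian vector: every linear functional is normally distributed,
  where almost sure constants count as normal with zero variance. The degenerate case is
  separate because a constant has no Lebesgue density.\<close>

definition gaussian_vector :: "'a measure \<Rightarrow> ('a \<Rightarrow> real ^ 'n) \<Rightarrow> bool" where
  "gaussian_vector M X \<longleftrightarrow>
     X \<in> borel_measurable M \<and>
     (\<forall>a. (\<exists>\<mu>. AE \<omega> in M. a \<bullet> X \<omega> = \<mu>) \<or>
          (\<exists>\<mu> \<sigma>. 0 < \<sigma> \<and> distributed M lborel (\<lambda>\<omega>. a \<bullet> X \<omega>) (normal_density \<mu> \<sigma>)))"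

definition outer :: "real ^ 'n \<Rightarrow> real ^ 'm \<Rightarrow> real ^ 'm ^ 'n" where
  "outer x y = (\<chi> i j. x $ i * y $ j)"

definition second_moment :: "'a measure \<Rightarrow> ('a \<Rightarrow> real ^ 'n) \<Rightarrow> real ^ 'n ^ 'n" where
  "second_moment M X = (\<chi> i j. \<integral>\<omega>. outer (X \<omega>) (X \<omega>) $ i $ j \<partial>M)"

text \<open>Componentwise conditional expectation. As for \<^const>\<open>real_cond_exp\<close>, the value is meaningful
  only for integrable components and for \<open>F\<close> a subalgebra of \<open>M\<close>.\<close>

definition vec_cond_exp ::
    "'a measure \<Rightarrow> 'a measure \<Rightarrow> ('a \<Rightarrow> real ^ 'n) \<Rightarrow> 'a \<Rightarrow> real ^ 'n" where
  "vec_cond_exp M F X \<omega> = (\<chi> i. real_cond_exp M F (\<lambda>\<omega>'. X \<omega>' $ i) \<omega>)"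

definition mat_cond_exp ::
    "'a measure \<Rightarrow> 'a measure \<Rightarrow> ('a \<Rightarrow> real ^ 'm ^ 'n) \<Rightarrow> 'a \<Rightarrow> real ^ 'm ^ 'n" where
  "mat_cond_exp M F X \<omega> = (\<chi> i j. real_cond_exp M F (\<lambda>\<omega>'. X \<omega>' $ i $ j) \<omega>)"

definition cond_cov ::
    "'a measure \<Rightarrow> 'a measure \<Rightarrow> ('a \<Rightarrow> real ^ 'n) \<Rightarrow> 'a \<Rightarrow> real ^ 'n ^ 'n" where
  "cond_cov M F X =
     mat_cond_exp M F (\<lambda>\<omega>. outer (X \<omega> - vec_cond_exp M F X \<omega>) (X \<omega> - vec_cond_exp M F X \<omega>))"

text \<open>The primitive sources of randomness. The tag type is needed because \<^const>\<open>prob_space.indep_vars\<close>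
  requires all variables of a family to have the same value type, whereas the disturbances and
  the measurement noises have different dimensions.\<close>

datatype source = Initial | Disturbance nat | Measurement_Noise nat

definition independent_sources ::
    "'a measure \<Rightarrow> ('a \<Rightarrow> real ^ 'n) \<Rightarrow> (nat \<Rightarrow> 'a \<Rightarrow> real ^ 'n) \<Rightarrow> (nat \<Rightarrow> 'a \<Rightarrow> real ^ 'p) \<Rightarrow> bool"
  where
  "independent_sources M x0 w v \<longleftrightarrow>
     prob_space.indep_sets M
       (\<lambda>s. case s of
          Initial \<Rightarrow> sets (rv_algebra M x0)
        | Disturbance k \<Rightarrow> sets (rv_algebra M (w k))
        | Measurement_Noise k \<Rightarrow> sets (rv_algebra M (v k))) UNIV"

end

theory Submission
  imports Defs
begin

text \<open>
  The inputs cancel from the prediction error \<open>e\<^sub>k = x\<^sub>k - xh\<^sub>k\<close>, so \<open>e\<^sub>k\<close> and the innovations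
  \<open>\<nu>\<^sub>k = C\<^sub>k e\<^sub>k + v\<^sub>k\<close> are linear in the primitive noise sources, and the estimate at time \<open>k\<close> is a
  function of \<open>\<nu>\<^sub>0, \<dots>, \<nu>\<^bsub>k-1\<^esub>\<close>. One shows by induction that, conditionally on any event
  prescribing Borel ranges for the coordinates of these innovations, \<open>e\<^sub>k\<close> has the characteristic
  function of \<open>N(0, P\<^sub>k)\<close>: the gain makes the joint characteristic function of \<open>e\<^bsub>k+1\<^esub>\<close> and \<open>\<nu>\<^sub>k\<close>
  factor, and uniqueness of Fourier transforms turns the factor \<open>exp (i b \<bullet> \<nu>\<^sub>k)\<close> into the indicator
  of a new event. First and second moments on these events then extend to the generated
  \<open>\<sigma>\<close>-algebra.
\<close>

subsection \<open>The Riccati recursion\<close>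

lemma inner_matrix_vector_mult:
  fixes A :: "real ^ 'n ^ 'm"
  shows "a \<bullet> (A *v x) = (transpose A *v a) \<bullet> x"
  by (simp add: dot_lmul_matrix)

lemma matrix_inv_mult:
  fixes S :: "real ^ 'n ^ 'n"
  assumes "invertible S"
  shows "S ** matrix_inv S = mat 1" "matrix_inv S ** S = mat 1"
  using someI_ex[OF assms[unfolded invertible_def]] unfolding matrix_inv_def by blast+

lemma transpose_matrix_add:
  fixes A B :: "real ^ 'n ^ 'm"
  shows "transpose (A + B) = transpose A + transpose B"
  by (simp add: transpose_def vec_eq_iff)

lemma transpose_matrix_diff:
  fixes A B :: "real ^ 'n ^ 'm"
  shows "transpose (A - B) = transpose A - transpose B"
  by (simp add: transpose_def vec_eq_iff)

text \<open>Transposing \<open>S ** matrix_inv S = mat 1\<close> makes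
  \<open>transpose (matrix_inv S)\<close> a left inverse of \<open>S\<close>, and a left inverse
  agrees with the right inverse.\<close>

lemma transpose_matrix_inv:
  fixes S :: "real ^ 'n ^ 'n"
  assumes "invertible S" "transpose S = S"
  shows "transpose (matrix_inv S) = matrix_inv S"
proof -
  have "transpose (matrix_inv S) ** S = mat 1"
    using arg_cong[OF matrix_inv_mult(1)[OF assms(1)], of transpose] assms(2)
    by (simp add: matrix_transpose_mul)
  then have "(transpose (matrix_inv S) ** S) ** matrix_inv S = matrix_inv S"
    by simp
  then show ?thesis
    using matrix_inv_mult(1)[OF assms(1)] by (simp add: matrix_mul_assoc[symmetric])
qed

text \<open>Carries symmetry of \<open>P\<close> through one step of the recursion. Symmetry merges
  the cross terms of the quadratic forms and later identifies the off-diagonal covariances by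
  polarization.\<close>

lemma riccati_symmetric:
  fixes A P Q :: "real ^ 'n ^ 'n" and C :: "real ^ 'n ^ 'p" and R :: "real ^ 'p ^ 'p"
  assumes sym: "transpose P = P" "transpose Q = Q" "transpose R = R"
    and S: "S = C ** P ** transpose C + R" "invertible S"
  shows "transpose (A ** P ** transpose A + Q
      - A ** P ** transpose C ** matrix_inv S ** C ** P ** transpose A)
    = A ** P ** transpose A + Q - A ** P ** transpose C ** matrix_inv S ** C ** P ** transpose A"
proof -
  have "transpose S = S"
    by (simp add: S(1) sym transpose_matrix_add matrix_transpose_mul matrix_mul_assoc)
  then have "transpose (matrix_inv S) = matrix_inv S"
    using S(2) by (rule transpose_matrix_inv[rotated])
  then show ?thesis
    by (simp add: sym transpose_matrix_add transpose_matrix_diff matrix_transpose_mul matrix_mul_assoc)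
qed

text \<open>The left-hand side is the variance of \<open>a \<bullet> e' + b \<bullet> \<nu>\<close>, where \<open>e' = A e + w - K \<nu>\<close> is
  the next prediction error and \<open>\<nu> = C e + v\<close> the innovation. The gain is what removes the
  covariance term between the two.\<close>

lemma riccati_quadratic_form:
  fixes A P Q :: "real ^ 'n ^ 'n" and C :: "real ^ 'n ^ 'p" and R :: "real ^ 'p ^ 'p"
    and K :: "real ^ 'p ^ 'n"
  assumes sym: "transpose P = P" "transpose R = R"
    and S: "S = C ** P ** transpose C + R" "invertible S"
    and K: "K = A ** P ** transpose C ** matrix_inv S"
    and P': "P' = A ** P ** transpose A + Q
      - A ** P ** transpose C ** matrix_inv S ** C ** P ** transpose A"
    and \<beta>: "\<beta> = b - transpose K *v a"
    and \<alpha>: "\<alpha> = transpose A *v a + transpose C *v \<beta>"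
  shows "\<alpha> \<bullet> (P *v \<alpha>) + a \<bullet> (Q *v a) + \<beta> \<bullet> (R *v \<beta>) = a \<bullet> (P' *v a) + b \<bullet> (S *v b)"
proof -
  define h where "h = transpose A *v a"
  define g where "g = transpose K *v a"
  have symS: "transpose S = S"
    by (simp add: S(1) sym transpose_matrix_add matrix_transpose_mul matrix_mul_assoc)
  have inv: "transpose (matrix_inv S) = matrix_inv S"
    using S(2) symS by (rule transpose_matrix_inv)
  have swap: "x \<bullet> (P *v y) = y \<bullet> (P *v x)" for x y
    by (metis inner_matrix_vector_mult sym(1) inner_commute)
  have swapS: "x \<bullet> (S *v y) = y \<bullet> (S *v x)" for x y
    by (metis inner_matrix_vector_mult symS inner_commute)
  \<comment> \<open>The defining property of the gain with the inverse cleared: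
    \<open>S *v g\<close> can replace \<open>C *v (P *v h)\<close> in the cross terms.\<close>
  have "S ** transpose K = C ** P ** transpose A"
  proof -
    have "S ** transpose K = (S ** matrix_inv S) ** (C ** P ** transpose A)"
      by (simp add: K matrix_transpose_mul inv sym matrix_mul_assoc)
    then show ?thesis by (simp add: matrix_inv_mult[OF S(2)])
  qed
  then have Sg: "S *v g = C *v (P *v h)"
    by (simp add: g_def h_def matrix_vector_mul_assoc matrix_mul_assoc del: transpose_matrix_vector)
  have Sx: "x \<bullet> (S *v x) = x \<bullet> (C *v (P *v (transpose C *v x))) + x \<bullet> (R *v x)" for x
    by (simp add: S(1) matrix_vector_mult_add_rdistrib inner_add_right
        matrix_vector_mul_assoc[symmetric] del: transpose_matrix_vector)
  have P'a: "a \<bullet> (P' *v a) = h \<bullet> (P *v h) + a \<bullet> (Q *v a) - g \<bullet> (C *v (P *v h))"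
  proof -
    have "P' = A ** (P ** transpose A) + Q - K ** (C ** (P ** transpose A))"
      by (simp add: P' K matrix_mul_assoc)
    then have "a \<bullet> (P' *v a) = a \<bullet> (A *v (P *v h)) + a \<bullet> (Q *v a) - a \<bullet> (K *v (C *v (P *v h)))"
      by (simp add: h_def matrix_vector_mult_add_rdistrib matrix_vector_mult_diff_rdistrib inner_add_right
          inner_diff_right matrix_vector_mul_assoc[symmetric] del: transpose_matrix_vector)
    then show ?thesis
      using inner_matrix_vector_mult[of a A "P *v h"] inner_matrix_vector_mult[of a K "C *v (P *v h)"]
      by (simp add: h_def g_def)
  qed
  have \<beta>b: "b = \<beta> + g" by (simp add: \<beta> g_def)
  have tC: "(transpose C *v x) \<bullet> y = x \<bullet> (C *v y)" for x y
    by (simp add: dot_lmul_matrix)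
  have "\<alpha> \<bullet> (P *v \<alpha>) = h \<bullet> (P *v h) + 2 * (\<beta> \<bullet> (C *v (P *v h)))
      + \<beta> \<bullet> (C *v (P *v (transpose C *v \<beta>)))"
    unfolding \<alpha> h_def[symmetric]
    by (simp add: matrix_vector_right_distrib inner_add_left inner_add_right swap[of h "transpose C *v \<beta>"] tC
        del: transpose_matrix_vector)
  then have "\<alpha> \<bullet> (P *v \<alpha>) + \<beta> \<bullet> (R *v \<beta>) = h \<bullet> (P *v h) + 2 * (\<beta> \<bullet> (S *v g)) + \<beta> \<bullet> (S *v \<beta>)"
    by (simp add: Sx Sg)
  \<comment> \<open>Completing the square with \<open>b = \<beta> + g\<close>; the leftover
    \<open>g \<bullet> (S *v g)\<close> is exactly what the Riccati recursion subtracts.\<close>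
  also have "\<dots> = h \<bullet> (P *v h) + b \<bullet> (S *v b) - g \<bullet> (S *v g)"
    by (simp add: \<beta>b matrix_vector_right_distrib inner_add_left inner_add_right swapS[of g \<beta>])
  finally show ?thesis
    by (simp add: P'a Sg)
qed

subsection \<open>Uniqueness of Fourier transforms\<close>

context prob_space
begin

lemma integrable_bounded:
  fixes f :: "'a \<Rightarrow> 'b :: {banach, second_countable_topology}"
  assumes "f \<in> borel_measurable M" "\<And>\<omega>. \<omega> \<in> space M \<Longrightarrow> norm (f \<omega>) \<le> B"
  shows "integrable M f"
  using assms by (intro integrable_const_bound[of _ B]) auto

lemma integrable_indicator_events:
  assumes "G \<in> events"
  shows "integrable M (indicator G :: 'a \<Rightarrow> real)"
  using assms by (intro integrable_bounded[of _ 1]) (auto simp: indicator_def)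

text \<open>Levy's theorem needs a probability measure; since \<open>W\<close> is bounded with mean zero, \<open>1 + c W\<close>
  is a probability density for small \<open>c > 0\<close>.\<close>

lemma fourier_unique_real:
  fixes W X :: "'a \<Rightarrow> real"
  assumes [measurable]: "W \<in> borel_measurable M" "X \<in> borel_measurable M" "S \<in> sets borel"
    and B: "\<And>\<omega>. \<omega> \<in> space M \<Longrightarrow> \<bar>W \<omega>\<bar> \<le> B"
    and zero: "\<And>t. (CLINT \<omega>|M. W \<omega> * iexp (t * X \<omega>)) = 0"
  shows "(\<integral>\<omega>. W \<omega> * indicator S (X \<omega>) \<partial>M) = 0"
proof -
  \<comment> \<open>On the space \<open>\<bar>W \<omega>\<bar> \<le> \<bar>B\<bar> + 1\<close>, so
    \<open>c * W\<close> stays within [-1, 1]; the added 1 keeps the denominator positive even for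
    \<open>B = 0\<close>.\<close>
  define c where "c = 1 / (\<bar>B\<bar> + 1)"
  have c: "c > 0" by (simp add: c_def)
  have nonneg: "0 \<le> 1 + c * W \<omega>" if "\<omega> \<in> space M" for \<omega>
  proof -
    have "\<bar>c * W \<omega>\<bar> \<le> c * (\<bar>B\<bar> + 1)"
      unfolding abs_mult using c B[OF that] by (intro mult_mono) auto
    also have "\<dots> = 1" by (simp add: c_def)
    finally show ?thesis by linarith
  qed
  have W: "integrable M W" by (rule integrable_bounded[of _ B]) (use B in auto)
  \<comment> \<open>Frequency 0 of the hypothesis: \<open>W\<close> has mean zero, so
    \<open>1 + c * W\<close> has total mass one.\<close>
  have "(CLINT \<omega>|M. complex_of_real (W \<omega>)) = 0" using zero[of 0] by simp
  then have W0: "(\<integral>\<omega>. W \<omega> \<partial>M) = 0" by simp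
  define D where "D = density M (\<lambda>\<omega>. ennreal (1 + c * W \<omega>))"
  have "(\<integral>\<^sup>+ \<omega>. ennreal (1 + c * W \<omega>) \<partial>M) = ennreal (\<integral>\<omega>. 1 + c * W \<omega> \<partial>M)"
    using W nonneg by (intro nn_integral_eq_integral) auto
  also have "\<dots> = 1" using W W0 by (simp add: prob_space)
  finally have "prob_space D"
    unfolding D_def by (intro prob_spaceI) (simp add: emeasure_density cong: nn_integral_cong)
  then interpret D: prob_space D .
  have [measurable]: "X \<in> borel_measurable D" by (simp add: D_def)
  have spaceD: "space D = space M" by (simp add: D_def)
  have intX: "integrable M (\<lambda>\<omega>. iexp (t * X \<omega>))" for t
    by (rule integrable_bounded[of _ 1]) auto
  have intWX: "integrable M (\<lambda>\<omega>. W \<omega> * iexp (t * X \<omega>))" for t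
    by (rule integrable_bounded[of _ B]) (use B in \<open>auto simp: norm_mult\<close>)
  have "char (distr D borel X) t = char (distr M borel X) t" for t
  proof -
    have "char (distr D borel X) t = (CLINT \<omega>|D. iexp (t * X \<omega>))"
      unfolding char_def by (subst integral_distr) auto
    also have "\<dots> = (CLINT \<omega>|M. (1 + c * W \<omega>) *\<^sub>R iexp (t * X \<omega>))"
      unfolding D_def using nonneg by (subst integral_density) auto
    also have "\<dots> = (CLINT \<omega>|M. iexp (t * X \<omega>) + c * (W \<omega> * iexp (t * X \<omega>)))"
      by (intro Bochner_Integration.integral_cong) (auto simp: scaleR_conv_of_real algebra_simps)
    also have "\<dots> = (CLINT \<omega>|M. iexp (t * X \<omega>)) + c * (CLINT \<omega>|M. W \<omega> * iexp (t * X \<omega>))"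
      using intX intWX by (subst Bochner_Integration.integral_add) auto
    also have "\<dots> = char (distr M borel X) t"
      unfolding char_def zero by (subst integral_distr) auto
    finally show ?thesis .
  qed
  \<comment> \<open>The part of the transform with factor \<open>c\<close> vanishes by hypothesis,
    so reweighting by \<open>1 + c * W\<close> does not change the law of \<open>X\<close>.\<close>
  then have eq: "distr D borel X = distr M borel X"
    by (intro Levy_uniqueness ext D.real_distribution_distr real_distribution_distr) auto
  have iS: "integrable M (\<lambda>\<omega>. W \<omega> * indicator S (X \<omega>))"
    by (rule integrable_bounded[of _ "\<bar>B\<bar>"]) (use B in \<open>force simp: abs_mult indicator_def\<close>)+
  \<comment> \<open>Evaluating the two equal laws on \<open>S\<close> leaves \<open>c\<close> times
    the desired integral equal to zero.\<close>
  have "(\<integral>z. indicator S z \<partial>distr D borel X) = (\<integral>z. (indicator S z :: real) \<partial>distr M borel X)" (is "?l = ?r")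
    by (simp only: eq)
  moreover have "?l = (\<integral>\<omega>. (1 + c * W \<omega>) * indicator S (X \<omega>) \<partial>M)"
    unfolding D_def using nonneg by (subst integral_distr, simp, simp) (subst integral_density, auto)
  moreover have "\<dots> = (\<integral>\<omega>. indicator S (X \<omega>) + c * (W \<omega> * indicator S (X \<omega>)) \<partial>M)"
    by (intro Bochner_Integration.integral_cong) (auto simp: algebra_simps)
  moreover have "\<dots> = (\<integral>\<omega>. indicator S (X \<omega>) \<partial>M) + c * (\<integral>\<omega>. W \<omega> * indicator S (X \<omega>) \<partial>M)"
    using iS by (subst Bochner_Integration.integral_add)
      (auto intro!: integrable_bounded[of _ 1] simp: indicator_def)
  moreover have "?r = (\<integral>\<omega>. indicator S (X \<omega>) \<partial>M)"
    by (subst integral_distr) auto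
  ultimately show ?thesis using c by simp
qed

text \<open>The transform of \<open>cnj (W \<omega>)\<close> at \<open>t\<close> is the conjugate of
  the transform of \<open>W\<close> at \<open>-t\<close>, so it vanishes too. Real and imaginary
  parts are combinations of \<open>W\<close> and its conjugate, and the real case applies to
  each.\<close>

lemma fourier_unique_complex:
  fixes W :: "'a \<Rightarrow> complex" and X :: "'a \<Rightarrow> real"
  assumes [measurable]: "W \<in> borel_measurable M" "X \<in> borel_measurable M" "S \<in> sets borel"
    and B: "\<And>\<omega>. \<omega> \<in> space M \<Longrightarrow> cmod (W \<omega>) \<le> B"
    and zero: "\<And>t. (CLINT \<omega>|M. W \<omega> * iexp (t * X \<omega>)) = 0"
  shows "(CLINT \<omega>|M. W \<omega> * indicator S (X \<omega>)) = 0"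
proof -
  have intW: "integrable M (\<lambda>\<omega>. W \<omega> * iexp (t * X \<omega>))" for t
    by (rule integrable_bounded[of _ B]) (use B in \<open>auto simp: norm_mult\<close>)
  have [measurable]: "(\<lambda>\<omega>. cnj (W \<omega>)) \<in> borel_measurable M"
    by (rule borel_measurable_continuous_on[of cnj]) (auto intro: continuous_intros)
  have intC: "integrable M (\<lambda>\<omega>. cnj (W \<omega>) * iexp (t * X \<omega>))" for t
    by (rule integrable_bounded[of _ B]) (use B in \<open>auto simp: norm_mult\<close>)
  have zero': "(CLINT \<omega>|M. cnj (W \<omega>) * iexp (t * X \<omega>)) = 0" for t
  proof -
    have "(CLINT \<omega>|M. cnj (W \<omega>) * iexp (t * X \<omega>)) = (CLINT \<omega>|M. cnj (W \<omega> * iexp ((-t) * X \<omega>)))"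
      by (intro Bochner_Integration.integral_cong) (auto simp: exp_cnj)
    also have "\<dots> = cnj (CLINT \<omega>|M. W \<omega> * iexp ((-t) * X \<omega>))" by (rule Bochner_Integration.integral_cnj)
    also have "\<dots> = 0" by (simp only: zero complex_cnj_zero)
    finally show ?thesis .
  qed
  have re: "(CLINT \<omega>|M. Re (W \<omega>) * iexp (t * X \<omega>)) = 0" for t
  proof -
    have "(CLINT \<omega>|M. Re (W \<omega>) * iexp (t * X \<omega>))
      = (CLINT \<omega>|M. (W \<omega> * iexp (t * X \<omega>) + cnj (W \<omega>) * iexp (t * X \<omega>)) / 2)"
      by (intro Bochner_Integration.integral_cong)
        (auto simp: complex_add_cnj[symmetric] distrib_right[symmetric] complex_add_cnj)
    also have "\<dots> = 0"
      using intW intC zero zero' by simp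
    finally show ?thesis .
  qed
  have im: "(CLINT \<omega>|M. Im (W \<omega>) * iexp (t * X \<omega>)) = 0" for t
  proof -
    have "(CLINT \<omega>|M. Im (W \<omega>) * iexp (t * X \<omega>))
      = (CLINT \<omega>|M. (W \<omega> * iexp (t * X \<omega>) - cnj (W \<omega>) * iexp (t * X \<omega>)) / (2 * \<i>))"
      by (intro Bochner_Integration.integral_cong refl)
        (simp add: left_diff_distrib[symmetric] complex_diff_cnj field_simps)
    also have "\<dots> = 0"
      using intW intC zero zero' by simp
    finally show ?thesis .
  qed
  have intS: "integrable M (\<lambda>\<omega>. W \<omega> * indicator S (X \<omega>))"
  proof (rule integrable_bounded[of _ "\<bar>B\<bar>"])
    show "norm (W \<omega> * indicator S (X \<omega>)) \<le> \<bar>B\<bar>" if "\<omega> \<in> space M" for \<omega>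
      using B[OF that] by (auto simp: indicator_def)
  qed simp
  have "Re (CLINT \<omega>|M. W \<omega> * indicator S (X \<omega>)) = (\<integral>\<omega>. Re (W \<omega>) * indicator S (X \<omega>) \<partial>M)"
    by (subst integral_Re[symmetric, OF intS], intro Bochner_Integration.integral_cong)
      (auto simp: indicator_def)
  also have "\<dots> = 0"
    using B re by (intro fourier_unique_real[of _ _ _ B]) (auto intro: order_trans[OF abs_Re_le_cmod])
  finally have 1: "Re (CLINT \<omega>|M. W \<omega> * indicator S (X \<omega>)) = 0" .
  have "Im (CLINT \<omega>|M. W \<omega> * indicator S (X \<omega>)) = (\<integral>\<omega>. Im (W \<omega>) * indicator S (X \<omega>) \<partial>M)"
    by (subst integral_Im[symmetric, OF intS], intro Bochner_Integration.integral_cong)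
      (auto simp: indicator_def)
  also have "\<dots> = 0"
    using B im by (intro fourier_unique_real[of _ _ _ B]) (auto intro: order_trans[OF abs_Im_le_cmod])
  finally show ?thesis using 1 by (simp add: complex_eq_iff)
qed

text \<open>Trades exponentials for indicators one coordinate at a time. The exponentials of the
  remaining coordinates are absorbed into the weight while the scalar result handles the current
  one, which is why the induction ranges over all weights \<open>W\<close>.\<close>

lemma fourier_unique_rectangle:
  fixes W :: "'a \<Rightarrow> complex" and X :: "'i \<Rightarrow> 'a \<Rightarrow> real"
  assumes "finite J" "W \<in> borel_measurable M" "\<And>j. X j \<in> borel_measurable M"
    and "\<And>j. S j \<in> sets borel"
    and "\<And>\<omega>. \<omega> \<in> space M \<Longrightarrow> cmod (W \<omega>) \<le> B"
    and "\<And>b. (CLINT \<omega>|M. W \<omega> * iexp (\<Sum>j\<in>J. b j * X j \<omega>)) = 0"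
  shows "(CLINT \<omega>|M. W \<omega> * (\<Prod>j\<in>J. indicator (S j) (X j \<omega>))) = 0"
  using assms
proof (induction J arbitrary: W rule: finite_induct)
  case empty
  then show ?case by simp
next
  case (insert i J)
  note [measurable] = insert.prems(1,2,3)
  note B = insert.prems(4)
  define W' where "W' \<omega> = W \<omega> * indicator (S i) (X i \<omega>)" for \<omega>
  have [measurable]: "W' \<in> borel_measurable M" unfolding W'_def by measurable
  have "(CLINT \<omega>|M. W' \<omega> * (\<Prod>j\<in>J. indicator (S j) (X j \<omega>))) = 0"
  proof (rule insert.IH)
    show "cmod (W' \<omega>) \<le> B" if "\<omega> \<in> space M" for \<omega>
      using B[OF that] order_trans[OF norm_ge_zero B[OF that]] by (auto simp: W'_def indicator_def)
    fix b :: "'i \<Rightarrow> real"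
    have "(CLINT \<omega>|M. (W \<omega> * iexp (\<Sum>j\<in>J. b j * X j \<omega>)) * indicator (S i) (X i \<omega>)) = 0"
    proof (rule fourier_unique_complex)
      show "cmod (W \<omega> * iexp (\<Sum>j\<in>J. b j * X j \<omega>)) \<le> B" if "\<omega> \<in> space M" for \<omega>
        using B[OF that] by (simp add: norm_mult)
      fix t :: real
      \<comment> \<open>Overwriting the frequency at \<open>i\<close>, which lies outside
        \<open>J\<close>, frees it without disturbing the other terms.\<close>
      have "(\<Sum>j\<in>insert i J. (b(i := t)) j * X j \<omega>) = t * X i \<omega> + (\<Sum>j\<in>J. b j * X j \<omega>)" for \<omega>
        using insert.hyps by (auto intro!: sum.cong)
      then show "(CLINT \<omega>|M. (W \<omega> * iexp (\<Sum>j\<in>J. b j * X j \<omega>)) * iexp (t * X i \<omega>)) = 0"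
        using insert.prems(5)[of "b(i := t)"] by (simp add: exp_add distrib_left ac_simps)
    qed measurable
    then show "(CLINT \<omega>|M. W' \<omega> * iexp (\<Sum>j\<in>J. b j * X j \<omega>)) = 0"
      by (simp add: W'_def ac_simps)
  qed measurable
  then show ?case using insert.hyps by (simp add: W'_def ac_simps)
qed

subsection \<open>Gaussian characteristic functions and moments\<close>

text \<open>Standardizing gives the standard normal characteristic function at \<sigma>. Frequency 1
  suffices, since the vector \<open>a\<close> of a linear functional already carries the
  frequency.\<close>

lemma normal_iexp_expectation:
  assumes \<sigma>: "0 < \<sigma>" and D: "distributed M lborel X (normal_density \<mu> \<sigma>)"
  shows "(CLINT \<omega>|M. iexp (X \<omega> - \<mu>)) = exp (- (\<sigma>\<^sup>2) / 2)"
proof -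
  define Y where "Y \<omega> = (X \<omega> - \<mu>) / \<sigma>" for \<omega>
  have DY: "distributed M lborel Y std_normal_density"
    using D unfolding normal_standard_normal_convert[OF \<sigma>] Y_def .
  then have [measurable]: "Y \<in> borel_measurable M"
    using distributed_measurable by fastforce
  have "(CLINT \<omega>|M. iexp (X \<omega> - \<mu>)) = (CLINT \<omega>|M. iexp (\<sigma> * Y \<omega>))"
    using \<sigma> by (simp add: Y_def)
  also have "\<dots> = (CLINT z|distr M lborel Y. iexp (\<sigma> * z))"
    by (subst integral_distr) auto
  also have "\<dots> = char std_normal_distribution \<sigma>"
    using DY by (simp add: distributed_distr_eq_density char_def)
  also have "\<dots> = exp (- (\<sigma>\<^sup>2) / 2)"
    by (simp add: char_std_normal_distribution)
  finally show ?thesis .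
qed

text \<open>An almost sure constant behaves as a normal variable of variance zero, so both
  alternatives obey one formula.\<close>

lemma gaussian_real:
  fixes X :: "'a \<Rightarrow> real"
  assumes [measurable]: "X \<in> borel_measurable M"
    and X: "(\<exists>\<mu>. AE \<omega> in M. X \<omega> = \<mu>) \<or>
      (\<exists>\<mu> \<sigma>. 0 < \<sigma> \<and> distributed M lborel X (normal_density \<mu> \<sigma>))"
  shows "integrable M X" "integrable M (\<lambda>\<omega>. (X \<omega>)\<^sup>2)"
    "(CLINT \<omega>|M. iexp (X \<omega> - expectation X)) = exp (- (variance X) / 2)"
proof -
  have "integrable M X \<and> integrable M (\<lambda>\<omega>. (X \<omega>)\<^sup>2) \<and>
    (CLINT \<omega>|M. iexp (X \<omega> - expectation X)) = exp (- (variance X) / 2)"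
    using X
  proof (elim disjE exE conjE)
    fix \<mu> assume AE: "AE \<omega> in M. X \<omega> = \<mu>"
    have 1: "integrable M X"
      using AE by (subst integrable_cong_AE[of _ _ "\<lambda>_. \<mu>"]) auto
    have "AE \<omega> in M. (X \<omega>)\<^sup>2 = \<mu>\<^sup>2" using AE by eventually_elim simp
    then have 2: "integrable M (\<lambda>\<omega>. (X \<omega>)\<^sup>2)"
      by (subst integrable_cong_AE[of _ _ "\<lambda>_. \<mu>\<^sup>2"]) auto
    have E: "expectation X = \<mu>"
      using AE by (subst integral_cong_AE[of _ _ "\<lambda>_. \<mu>"]) (auto simp: prob_space)
    have "AE \<omega> in M. (X \<omega> - \<mu>)\<^sup>2 = 0" using AE by eventually_elim simp
    then have V: "variance X = 0"
      unfolding E by (subst integral_cong_AE[of _ _ "\<lambda>_. 0"]) auto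
    have "AE \<omega> in M. iexp (X \<omega> - \<mu>) = 1" using AE by eventually_elim simp
    then have "(CLINT \<omega>|M. iexp (X \<omega> - \<mu>)) = 1"
      by (subst integral_cong_AE[of _ _ "\<lambda>_. 1"]) (auto simp: prob_space)
    then show ?thesis using 1 2 E V by simp
  next
    fix \<mu> \<sigma> :: real
    assume \<sigma>: "0 < \<sigma>" and D: "distributed M lborel X (normal_density \<mu> \<sigma>)"
    have 1: "integrable M X"
      using distributed_integrable[OF D, of "\<lambda>x. x"] integrable_normal_moment_nz_1[OF \<sigma>, of \<mu>]
      by (simp add: normal_density_nonneg)
    have "integrable M (\<lambda>\<omega>. (X \<omega> - \<mu>)\<^sup>2)"
      using distributed_integrable[OF D, of "\<lambda>x. (x - \<mu>)\<^sup>2"] integrable_normal_moment[OF \<sigma>, of \<mu> 2]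
      by (simp add: normal_density_nonneg)
    then have "integrable M (\<lambda>\<omega>. (X \<omega> - \<mu>)\<^sup>2 + 2 * \<mu> * X \<omega> - \<mu>\<^sup>2)"
      using 1 by simp
    then have 2: "integrable M (\<lambda>\<omega>. (X \<omega>)\<^sup>2)"
      by (simp add: power2_diff mult.commute mult.left_commute)
    show ?thesis
      using 1 2 normal_iexp_expectation[OF \<sigma> D] normal_distributed_expectation[OF \<sigma> D]
        normal_distributed_variance[OF \<sigma> D] by simp
  qed
  then show "integrable M X" "integrable M (\<lambda>\<omega>. (X \<omega>)\<^sup>2)"
    "(CLINT \<omega>|M. iexp (X \<omega> - expectation X)) = exp (- (variance X) / 2)" by auto
qed

text \<open>By Levy's theorem \<open>X\<close> has the law of \<open>sqrt s\<close> times a standard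
  normal variable. Integrability and both moments are transferred from there.\<close>

lemma gaussian_char_moments:
  fixes X :: "'a \<Rightarrow> real" and s :: real
  assumes [measurable]: "X \<in> borel_measurable M"
    and char: "\<And>t. (CLINT \<omega>|M. iexp (t * X \<omega>)) = exp (- (s * t\<^sup>2) / 2)"
  shows "integrable M X" "integrable M (\<lambda>\<omega>. (X \<omega>)\<^sup>2)" "expectation X = 0"
    "expectation (\<lambda>\<omega>. (X \<omega>)\<^sup>2) = s"
proof -
  interpret std: real_distribution std_normal_distribution by (rule real_dist_normal_dist)
  have charX: "char (distr M borel X) t = exp (- (s * t\<^sup>2) / 2)" for t
    unfolding char_def using char by (subst integral_distr) auto
  interpret X: real_distribution "distr M borel X"
    by (rule real_distribution_distr) simp
  \<comment> \<open>A characteristic function has modulus at most 1; at frequency 1 this forces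
    \<open>s\<close> to be nonnegative.\<close>
  have "exp (- s / 2) \<le> 1"
    using X.cmod_char_le_1[of 1] unfolding charX by simp
  then have s: "s \<ge> 0" by simp
  let ?Z = "distr std_normal_distribution borel (\<lambda>z. sqrt s * z)"
  have "char ?Z t = char (distr M borel X) t" for t
  proof -
    have "char ?Z t = char std_normal_distribution (t * sqrt s)"
      unfolding char_def by (subst integral_distr) (auto simp: mult.assoc)
    then show ?thesis
      using s by (simp add: char_std_normal_distribution charX power_mult_distrib mult.commute)
  qed
  then have eq: "?Z = distr M borel X"
    by (intro Levy_uniqueness ext std.real_distribution_distr real_distribution_distr) auto
  have int: "integrable std_normal_distribution (\<lambda>z. z)"
     "integrable std_normal_distribution (\<lambda>z. z\<^sup>2)"
    using integrable_std_normal_distribution_moment[of 1]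
      integrable_std_normal_distribution_moment[of 2] by auto
  have "integrable ?Z (\<lambda>x. x)"
    using integrable_mult_right[OF int(1), of "sqrt s"] by (subst integrable_distr_eq) simp_all
  then show "integrable M X"
    unfolding eq by (subst (asm) integrable_distr_eq) simp_all
  have "integrable std_normal_distribution (\<lambda>z. (sqrt s * z)\<^sup>2)"
    unfolding power_mult_distrib using int(2) by (rule integrable_mult_right)
  then have "integrable ?Z (\<lambda>x. x\<^sup>2)"
    by (subst integrable_distr_eq) measurable
  then show "integrable M (\<lambda>\<omega>. (X \<omega>)\<^sup>2)"
    unfolding eq by (subst (asm) integrable_distr_eq) simp_all
  have "expectation X = (\<integral>x. x \<partial>?Z)"
    unfolding eq by (subst integral_distr) auto
  also have "\<dots> = sqrt s * (\<integral>z. z \<partial>std_normal_distribution)"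
    by (subst integral_distr) auto
  finally show "expectation X = 0"
    using integral_std_normal_distribution_moment_odd[of 1] by simp
  have "expectation (\<lambda>\<omega>. (X \<omega>)\<^sup>2) = (\<integral>x. x\<^sup>2 \<partial>?Z)"
    unfolding eq by (subst integral_distr) auto
  also have "\<dots> = s * (\<integral>z. z\<^sup>2 \<partial>std_normal_distribution)"
    using s by (subst integral_distr) (auto simp: power_mult_distrib)
  finally show "expectation (\<lambda>\<omega>. (X \<omega>)\<^sup>2) = s"
    using std_normal_distribution_even_moments[of 1] by (simp add: fact_numeral)
qed

section \<open>Moments restricted to an event\<close>

lemma integral_uniform_measure:
  fixes f :: "'a \<Rightarrow> 'b :: {banach, second_countable_topology}"
  assumes [measurable]: "f \<in> borel_measurable M" "G \<in> events" and G: "prob G \<noteq> 0"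
  shows "(\<integral>\<omega>. f \<omega> \<partial>uniform_measure M G) = (1 / prob G) *\<^sub>R (\<integral>\<omega>. indicator G \<omega> *\<^sub>R f \<omega> \<partial>M)"
proof -
  have pos: "prob G > 0" using G by (simp add: zero_less_measure_iff)
  have "indicator G \<omega> / emeasure M G = ennreal (indicator G \<omega> / prob G)" for \<omega>
    using pos divide_ennreal[of 1 "prob G"] by (simp add: emeasure_eq_measure indicator_def)
  then have "uniform_measure M G = density M (\<lambda>\<omega>. ennreal (indicator G \<omega> / prob G))"
    by (simp add: uniform_measure_def)
  then have "(\<integral>\<omega>. f \<omega> \<partial>uniform_measure M G) = (\<integral>\<omega>. (indicator G \<omega> / prob G) *\<^sub>R f \<omega> \<partial>M)"
    by (simp add: integral_density)
  also have "\<dots> = (\<integral>\<omega>. (1 / prob G) *\<^sub>R (indicator G \<omega> *\<^sub>R f \<omega>) \<partial>M)"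
    by (intro Bochner_Integration.integral_cong) (auto simp: indicator_def)
  \<comment> \<open>Scaling by \<open>prob G\<close> inverts the scaling by
    \<open>1 / prob G\<close>, so the factor can be pulled out even when the integrand is not
    integrable.\<close>
  also have "\<dots> = (1 / prob G) *\<^sub>R (\<integral>\<omega>. indicator G \<omega> *\<^sub>R f \<omega> \<partial>M)"
    using pos by (intro integral_bounded_linear'[OF bounded_linear_scaleR_right
          bounded_linear_scaleR_right[of "prob G"]]) simp
  finally show ?thesis .
qed

text \<open>Under the conditional probability given \<open>G\<close>, the variable has the
  characteristic function of N(0, \<open>s\<close>); multiplying its moments by
  \<open>prob G\<close> undoes the normalization. If \<open>G\<close> is null, all integrals over it
  vanish.\<close>

lemma gaussian_char_moments_on:
  fixes X :: "'a \<Rightarrow> real" and s :: real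
  assumes [measurable]: "X \<in> borel_measurable M" "G \<in> events"
    and char: "\<And>t. (CLINT \<omega>|M. indicator G \<omega> * iexp (t * X \<omega>)) = prob G * exp (- (s * t\<^sup>2) / 2)"
  shows "(\<integral>\<omega>. indicator G \<omega> * X \<omega> \<partial>M) = 0"
    "(\<integral>\<omega>. indicator G \<omega> * (X \<omega>)\<^sup>2 \<partial>M) = prob G * s"
proof -
  have "(\<integral>\<omega>. indicator G \<omega> * X \<omega> \<partial>M) = 0 \<and> (\<integral>\<omega>. indicator G \<omega> * (X \<omega>)\<^sup>2 \<partial>M) = prob G * s"
  proof (cases "prob G = 0")
    case True
    then have "G \<in> null_sets M" by (simp add: emeasure_eq_measure null_sets_def)
    then have ae: "AE \<omega> in M. \<omega> \<notin> G" by (rule AE_not_in)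
    have "(\<integral>\<omega>. indicator G \<omega> * X \<omega> \<partial>M) = 0"
      by (rule integral_eq_zero_AE) (use ae in eventually_elim, simp)
    moreover have "(\<integral>\<omega>. indicator G \<omega> * (X \<omega>)\<^sup>2 \<partial>M) = 0"
      by (rule integral_eq_zero_AE) (use ae in eventually_elim, simp)
    ultimately show ?thesis using True by simp
  next
    case False
    interpret U: prob_space "uniform_measure M G"
      using False by (intro prob_space_uniform_measure) (auto simp: emeasure_eq_measure)
    have [measurable]: "X \<in> borel_measurable (uniform_measure M G)"
      by simp
    have "(CLINT \<omega>|uniform_measure M G. iexp (t * X \<omega>)) = exp (- (s * t\<^sup>2) / 2)" for t
      using char[of t] False
      by (subst integral_uniform_measure) (auto simp: scaleR_conv_of_real of_real_indicator)
    note U.gaussian_char_moments[OF _ this]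
    then show ?thesis
      using False by (auto simp: integral_uniform_measure field_simps)
  qed
  then show "(\<integral>\<omega>. indicator G \<omega> * X \<omega> \<partial>M) = 0"
    "(\<integral>\<omega>. indicator G \<omega> * (X \<omega>)\<^sup>2 \<partial>M) = prob G * s" by auto
qed

text \<open>Dynkin's pi-lambda argument: a vanishing integral passes to complements because the
  whole space is a generator, and to countable disjoint unions because \<open>Z\<close> is
  integrable.\<close>

lemma integral_zero_sigma_sets:
  fixes Z :: "'a \<Rightarrow> real"
  assumes Z: "integrable M Z" and G: "Int_stable \<G>" "\<G> \<subseteq> events" "space M \<in> \<G>"
    and zero: "\<And>G. G \<in> \<G> \<Longrightarrow> (\<integral>\<omega>. indicator G \<omega> * Z \<omega> \<partial>M) = 0"
    and A: "A \<in> sigma_sets (space M) \<G>"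
  shows "(\<integral>\<omega>. indicator A \<omega> * Z \<omega> \<partial>M) = 0"
proof -
  have sub: "sigma_sets (space M) \<G> \<subseteq> events"
    using G(2) by (simp add: sets.sigma_sets_subset)
  have int: "integrable M (\<lambda>\<omega>. indicator B \<omega> * Z \<omega>)" if "B \<in> events" for B
    using integrable_mult_indicator[OF that Z] by simp
  have \<G>: "\<G> \<subseteq> Pow (space M)" using G(2) sets.sets_into_space by blast
  show ?thesis
    using G(1) \<G> A
  proof (induction rule: sigma_sets_induct_disjoint)
    case (basic A)
    then show ?case by (rule zero)
  next
    case empty
    then show ?case by simp
  next
    case (compl A)
    have "(\<integral>\<omega>. indicator (space M - A) \<omega> * Z \<omega> \<partial>M)
      = (\<integral>\<omega>. indicator (space M) \<omega> * Z \<omega> - indicator A \<omega> * Z \<omega> \<partial>M)"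
      by (intro Bochner_Integration.integral_cong) (auto simp: indicator_def)
    also have "\<dots> = 0"
      using compl sub int zero[OF G(3)] by (subst Bochner_Integration.integral_diff) auto
    finally show ?case .
  next
    case (union A)
    have A: "A i \<in> events" for i using union(2) sub by auto
    have "(LINT \<omega>:(\<Union>i. A i)|M. Z \<omega>) = (\<Sum>i. (LINT \<omega>:(A i)|M. Z \<omega>))"
      using A union(1) int[of "\<Union>i. A i"]
      by (intro lebesgue_integral_countable_add)
        (auto simp: disjoint_family_on_def set_integrable_def)
    then show ?case
      using union(3) by (simp add: set_lebesgue_integral_def)
  qed
qed

end

section \<open>Second-moment matrices of random vectors\<close>

lemma transpose_second_moment: "transpose (second_moment M X) = second_moment M X"
  by (simp add: second_moment_def outer_def transpose_def vec_eq_iff mult.commute)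

lemma integrable_vecI:
  fixes X :: "'a \<Rightarrow> real ^ 'n"
  assumes "\<And>a. integrable M (\<lambda>\<omega>. a \<bullet> X \<omega>)"
  shows "integrable M X"
proof -
  have "integrable M (\<lambda>\<omega>. \<Sum>b\<in>Basis. (b \<bullet> X \<omega>) *\<^sub>R b)"
    using assms by (intro Bochner_Integration.integrable_sum integrable_scaleR_left) auto
  then show ?thesis
    by (simp add: inner_commute[of _ "X _"] euclidean_representation)
qed

lemma inner_power2_sum:
  fixes a y :: "real ^ 'n"
  shows "(a \<bullet> y)\<^sup>2 = (\<Sum>i\<in>UNIV. \<Sum>j\<in>UNIV. a $ i * a $ j * (y $ i * y $ j))"
  by (simp add: inner_vec_def power2_eq_square sum_product algebra_simps)

text \<open>Polarization: a product of two coordinates is recovered from squares of linear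
  functionals, the case \<open>i = j\<close> included.\<close>

lemma inner_axis_sum_power2:
  fixes y :: "real ^ 'n"
  shows "((axis i 1 + axis j 1) \<bullet> y)\<^sup>2 = (y $ i)\<^sup>2 + 2 * (y $ i * y $ j) + (y $ j)\<^sup>2"
  by (simp add: inner_add_left inner_axis' power2_eq_square algebra_simps)

lemma integrable_component_mult:
  fixes Y :: "'a \<Rightarrow> real ^ 'n"
  assumes "\<And>a. integrable M (\<lambda>\<omega>. (a \<bullet> Y \<omega>)\<^sup>2)"
  shows "integrable M (\<lambda>\<omega>. Y \<omega> $ i * Y \<omega> $ j)"
proof -
  have "integrable M (\<lambda>\<omega>. (((axis i 1 + axis j 1) \<bullet> Y \<omega>)\<^sup>2
      - (axis i 1 \<bullet> Y \<omega>)\<^sup>2 - (axis j 1 \<bullet> Y \<omega>)\<^sup>2) / 2)"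
    using assms by (intro integrable_divide Bochner_Integration.integrable_diff)
  then show ?thesis
    unfolding inner_axis_sum_power2 by (simp add: inner_axis')
qed

lemma second_moment_quadratic:
  fixes Y :: "'a \<Rightarrow> real ^ 'n"
  assumes "\<And>a. integrable M (\<lambda>\<omega>. (a \<bullet> Y \<omega>)\<^sup>2)"
  shows "a \<bullet> (second_moment M Y *v a) = (\<integral>\<omega>. (a \<bullet> Y \<omega>)\<^sup>2 \<partial>M)"
proof -
  note int = integrable_component_mult[OF assms]
  have "(\<integral>\<omega>. (a \<bullet> Y \<omega>)\<^sup>2 \<partial>M)
    = (\<Sum>i\<in>UNIV. \<Sum>j\<in>UNIV. a $ i * a $ j * (\<integral>\<omega>. Y \<omega> $ i * Y \<omega> $ j \<partial>M))"
    using int by (simp add: inner_power2_sum)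
  also have "\<dots> = a \<bullet> (second_moment M Y *v a)"
    by (simp add: inner_vec_def matrix_vector_mult_def second_moment_def outer_def sum_distrib_left
        mult.assoc mult.commute)
  finally show ?thesis ..
qed

text \<open>The variance of each functional is the quadratic form of the centred second-moment
  matrix. Integrability of the vector, needed to move the expectation through the inner product,
  itself comes from the functionals.\<close>

lemma (in prob_space) gaussian_vector_char:
  fixes X :: "'a \<Rightarrow> real ^ 'n"
  assumes "gaussian_vector M X"
  shows "(CLINT \<omega>|M. iexp (a \<bullet> (X \<omega> - expectation X)))
      = exp (- (a \<bullet> (second_moment M (\<lambda>\<omega>. X \<omega> - expectation X) *v a)) / 2)"
proof -
  have [measurable]: "X \<in> borel_measurable M"
    using assms by (simp add: gaussian_vector_def)
  have *: "integrable M (\<lambda>\<omega>. a \<bullet> X \<omega>)" "integrable M (\<lambda>\<omega>. (a \<bullet> X \<omega>)\<^sup>2)"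
    "(CLINT \<omega>|M. iexp (a \<bullet> X \<omega> - expectation (\<lambda>\<omega>. a \<bullet> X \<omega>)))
      = exp (- (variance (\<lambda>\<omega>. a \<bullet> X \<omega>)) / 2)" for a
    using assms gaussian_real[of "\<lambda>\<omega>. a \<bullet> X \<omega>"] by (auto simp: gaussian_vector_def)
  have int: "integrable M X" using *(1) by (rule integrable_vecI)
  have E: "expectation (\<lambda>\<omega>. a \<bullet> X \<omega>) = a \<bullet> expectation X" for a
    using int by simp
  have "integrable M (\<lambda>\<omega>. (a \<bullet> (X \<omega> - expectation X))\<^sup>2)" for a
    using *(1,2)[of a] by (simp add: inner_diff_right power2_diff)
  note second_moment_quadratic[OF this, of a]
  then show "(CLINT \<omega>|M. iexp (a \<bullet> (X \<omega> - expectation X)))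
      = exp (- (a \<bullet> (second_moment M (\<lambda>\<omega>. X \<omega> - expectation X) *v a)) / 2)"
    using *(3)[of a] unfolding E by (simp add: inner_diff_right)
qed

lemma rv_algebra_measurable: "X \<in> borel_measurable (rv_algebra M X)"
  unfolding rv_algebra_def by (rule measurable_vimage_algebra1) simp

lemma sets_rv_algebra_subset:
  assumes "X \<in> measurable N borel" "space N = space M"
  shows "sets (rv_algebra M X) \<subseteq> sets N"
  using measurable_sets[OF assms(1)] assms(2)
  by (auto simp: rv_algebra_def sets_vimage_algebra2)

lemma matrix_vector_mult_borel_measurable [measurable]:
  fixes N :: "real ^ 'c ^ 'd"
  shows "(\<lambda>x. N *v x) \<in> borel_measurable borel"
  by (intro borel_measurable_continuous_onI linear_continuous_on) simp

subsection \<open>The prediction error and the innovations\<close>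

text \<open>The error recursion without inputs and estimates. Gaussianity and zero means enter only
  through characteristic functions, which treats degenerate and nondegenerate noise alike;
  \<open>S k\<close> is the covariance of the innovation.\<close>

locale kalman_error = prob_space M for M :: "'a measure" +
  fixes e w :: "nat \<Rightarrow> 'a \<Rightarrow> real ^ 'n"
    and v :: "nat \<Rightarrow> 'a \<Rightarrow> real ^ 'p"
    and A P Q :: "nat \<Rightarrow> real ^ 'n ^ 'n"
    and C :: "nat \<Rightarrow> real ^ 'n ^ 'p"
    and R S :: "nat \<Rightarrow> real ^ 'p ^ 'p"
    and K :: "nat \<Rightarrow> real ^ 'p ^ 'n"
  assumes step: "\<And>k \<omega>. \<omega> \<in> space M \<Longrightarrow>
      e (Suc k) \<omega> = A k *v e k \<omega> + w k \<omega> - K k *v (C k *v e k \<omega> + v k \<omega>)"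
    and source_measurable [measurable]: "e 0 \<in> borel_measurable M"
      "\<And>k. w k \<in> borel_measurable M" "\<And>k. v k \<in> borel_measurable M"
    and independent: "independent_sources M (e 0) w v"
    and char_initial: "\<And>a. (CLINT \<omega>|M. iexp (a \<bullet> e 0 \<omega>)) = exp (- (a \<bullet> (P 0 *v a)) / 2)"
    and char_disturbance: "\<And>k a. (CLINT \<omega>|M. iexp (a \<bullet> w k \<omega>)) = exp (- (a \<bullet> (Q k *v a)) / 2)"
    and char_noise: "\<And>k a. (CLINT \<omega>|M. iexp (a \<bullet> v k \<omega>)) = exp (- (a \<bullet> (R k *v a)) / 2)"
    and symmetric_initial: "transpose (P 0) = P 0"
    and symmetric_Q: "\<And>k. transpose (Q k) = Q k"
    and symmetric_R: "\<And>k. transpose (R k) = R k"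
    and S: "\<And>k. S k = C k ** P k ** transpose (C k) + R k"
    and invertible_S: "\<And>k. invertible (S k)"
    and K: "\<And>k. K k = A k ** P k ** transpose (C k) ** matrix_inv (S k)"
    and riccati: "\<And>k. P (Suc k) = A k ** P k ** transpose (A k) + Q k
      - A k ** P k ** transpose (C k) ** matrix_inv (S k) ** C k ** P k ** transpose (A k)"
begin

definition innovation :: "nat \<Rightarrow> 'a \<Rightarrow> real ^ 'p" where
  "innovation k \<omega> = C k *v e k \<omega> + v k \<omega>"

definition source_sets :: "source \<Rightarrow> 'a set set" where
  "source_sets s = (case s of
     Initial \<Rightarrow> sets (rv_algebra M (e 0))
   | Disturbance k \<Rightarrow> sets (rv_algebra M (w k))
   | Measurement_Noise k \<Rightarrow> sets (rv_algebra M (v k)))"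

text \<open>The bounds are strict because \<open>w k\<close> and \<open>v k\<close> first act on
  \<open>e (Suc k)\<close>: they are outside the past at time \<open>k\<close> and hence independent
  of it.\<close>

definition past_sources :: "nat \<Rightarrow> source set" where
  "past_sources k = {Initial} \<union> Disturbance ` {..<k} \<union> Measurement_Noise ` {..<k}"

definition past :: "nat \<Rightarrow> 'a measure" where
  "past k = sigma (space M) (\<Union>s\<in>past_sources k. source_sets s)"

lemma symmetric_P: "transpose (P k) = P k"
proof (induction k)
  case 0
  show ?case by (rule symmetric_initial)
next
  case (Suc k)
  show ?case
    unfolding riccati
    by (rule riccati_symmetric[OF Suc symmetric_Q symmetric_R S invertible_S])
qed

section \<open>The sigma-algebras of the noise sources and of the past\<close>

lemma source_sets_events: "source_sets s \<subseteq> events"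
  unfolding source_sets_def by (cases s) (auto dest!: subsetD[OF sets_rv_algebra_subset, rotated -1])

lemma source_sets_Int_stable: "Int_stable (source_sets s)"
  unfolding source_sets_def by (cases s) (auto simp: Int_stable_def)

lemma indep_source_sets: "indep_sets source_sets UNIV"
  using independent unfolding independent_sources_def source_sets_def[abs_def] .

lemma space_past [simp]: "space (past k) = space M"
  unfolding past_def by (rule space_measure_of_conv)

lemma sets_past: "sets (past k) = sigma_sets (space M) (\<Union>s\<in>past_sources k. source_sets s)"
  unfolding past_def using source_sets_events sets.sets_into_space
  by (intro sets_measure_of) blast

lemma sets_past_subset: "sets (past k) \<subseteq> events"
  unfolding sets_past using source_sets_events by (intro sets.sigma_sets_subset) blast

lemma measurable_past_mono:
  assumes "f \<in> measurable (past k) N" "k \<le> l"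
  shows "f \<in> measurable (past l) N"
proof -
  have "past_sources k \<subseteq> past_sources l"
    using assms(2) unfolding past_sources_def by fastforce
  then have "sets (past k) \<subseteq> sets (past l)"
    unfolding sets_past by (intro sigma_sets_mono') blast
  with assms(1) show ?thesis
    by (auto simp: measurable_def)
qed

lemma source_measurable_past:
  assumes "s \<in> past_sources k" "sets (rv_algebra M X) = source_sets s"
  shows "X \<in> borel_measurable (past k)"
proof -
  have "sets (rv_algebra M X) \<subseteq> sets (past k)"
    unfolding assms(2) sets_past using assms(1)
    by (intro sigma_sets_superset_generator[THEN subset_trans[rotated]]) blast
  then show ?thesis
    using rv_algebra_measurable[of X] by (auto simp: measurable_def rv_algebra_def)
qed

lemma error_measurable_past: "e k \<in> borel_measurable (past k)"
proof (induction k)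
  case 0
  show ?case
    by (rule source_measurable_past[of Initial]) (auto simp: past_sources_def source_sets_def)
next
  case (Suc k)
  have [measurable]: "e k \<in> borel_measurable (past (Suc k))"
    using Suc by (rule measurable_past_mono) simp
  have [measurable]: "w k \<in> borel_measurable (past (Suc k))"
    by (rule source_measurable_past[of "Disturbance k"]) (auto simp: past_sources_def source_sets_def)
  have [measurable]: "v k \<in> borel_measurable (past (Suc k))"
    by (rule source_measurable_past[of "Measurement_Noise k"])
      (auto simp: past_sources_def source_sets_def)
  have "(\<lambda>\<omega>. A k *v e k \<omega> + w k \<omega> - K k *v (C k *v e k \<omega> + v k \<omega>))
      \<in> borel_measurable (past (Suc k))"
    by measurable
  then show ?case
    by (subst measurable_cong[OF step]) auto
qed

lemma error_measurable [measurable]: "e k \<in> borel_measurable M"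
  using error_measurable_past[of k] sets_past_subset[of k] by (auto simp: measurable_def)

lemma innovation_measurable [measurable]: "innovation k \<in> borel_measurable M"
  unfolding innovation_def[abs_def] by measurable

section \<open>Independence of the past and the current noises\<close>

text \<open>The past, \<open>w k\<close> and \<open>v k\<close> come from three disjoint blocks of
  independent sources. Such blocks are again independent, so the expectation of a product of bounded
  functions of them factors.\<close>

lemma expectation_past_mult:
  fixes f :: "'a \<Rightarrow> complex"
  assumes f: "f \<in> borel_measurable (past k)"
    and bound: "\<And>\<omega>. \<omega> \<in> space M \<Longrightarrow> cmod (f \<omega>) \<le> 1"
  shows "(CLINT \<omega>|M. f \<omega> * iexp (a \<bullet> w k \<omega>) * iexp (b \<bullet> v k \<omega>))
    = (CLINT \<omega>|M. f \<omega>) * exp (- (a \<bullet> (Q k *v a)) / 2) * exp (- (b \<bullet> (R k *v b)) / 2)"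
proof -
  let ?J = "{Initial, Disturbance k, Measurement_Noise k}"
  \<comment> \<open>The tag \<open>Initial\<close> labels the whole past block and carries
    \<open>f\<close>; the other two tags label single sources.\<close>
  define I where "I s = (if s = Initial then past_sources k else {s})" for s
  define X where "X s = (case s of Initial \<Rightarrow> f
    | Disturbance i \<Rightarrow> (\<lambda>\<omega>. iexp (a \<bullet> w i \<omega>))
    | Measurement_Noise i \<Rightarrow> (\<lambda>\<omega>. iexp (b \<bullet> v i \<omega>)))" for s
  have [measurable]: "f \<in> borel_measurable M"
    using f sets_past_subset[of k] by (auto simp: measurable_def)
  have rv: "X s \<in> borel_measurable M" for s
    unfolding X_def by (cases s) simp_all
  have "indep_sets (\<lambda>s. sigma_sets (space M) (\<Union>i\<in>I s. source_sets i)) ?J"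
  proof (rule indep_sets_collect_sigma)
    show "indep_sets source_sets (\<Union>s\<in>?J. I s)"
      using indep_source_sets by (rule indep_sets_mono_index[rotated]) simp
    show "disjoint_family_on I ?J"
      by (auto simp: disjoint_family_on_def I_def past_sources_def)
  qed (rule source_sets_Int_stable)
  \<comment> \<open>Each factor generates only events of its own block, so independence passes from
    the blocks to the factors.\<close>
  moreover have "{X s -` B \<inter> space M |B. B \<in> sets borel} \<subseteq> sigma_sets (space M) (\<Union>i\<in>I s. source_sets i)"
    (is "?V s \<subseteq> _") if "s \<in> ?J" for s
  proof (cases s)
    case Initial
    then show ?thesis
      using measurable_sets[OF f] by (auto simp: X_def I_def sets_past[symmetric])
  next
    case (Disturbance i)
    have [measurable]: "w i \<in> borel_measurable (rv_algebra M (w i))"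
      by (rule rv_algebra_measurable)
    have "X s \<in> borel_measurable (rv_algebra M (w i))"
      unfolding X_def Disturbance by simp
    then have "?V s \<subseteq> source_sets s"
      using measurable_sets[of "X s" "rv_algebra M (w i)" borel]
      by (auto simp: Disturbance source_sets_def rv_algebra_def)
    then show ?thesis
      by (auto simp: I_def Disturbance)
  next
    case (Measurement_Noise i)
    have [measurable]: "v i \<in> borel_measurable (rv_algebra M (v i))"
      by (rule rv_algebra_measurable)
    have "X s \<in> borel_measurable (rv_algebra M (v i))"
      unfolding X_def Measurement_Noise by simp
    then have "?V s \<subseteq> source_sets s"
      using measurable_sets[of "X s" "rv_algebra M (v i)" borel]
      by (auto simp: Measurement_Noise source_sets_def rv_algebra_def)
    then show ?thesis
      by (auto simp: I_def Measurement_Noise)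
  qed
  ultimately have "indep_vars (\<lambda>_. borel) X ?J"
    unfolding indep_vars_def2 using rv by (blast intro: indep_sets_mono_sets)
  moreover have "integrable M (X s)" for s
    by (rule integrable_bounded[OF rv, of _ 1]) (use bound in \<open>auto simp: X_def split: source.split\<close>)
  ultimately have "(\<integral>\<omega>. (\<Prod>s\<in>?J. X s \<omega>) \<partial>M) = (\<Prod>s\<in>?J. \<integral>\<omega>. X s \<omega> \<partial>M)"
    by (intro indep_vars_lebesgue_integral) auto
  then show ?thesis
    by (simp add: X_def char_disturbance char_noise mult.assoc)
qed

section \<open>Characteristic function of the error on innovation rectangles\<close>

text \<open>Only innovations before time \<open>k\<close> are constrained, as suits a predictor. One
  family \<open>B\<close> serves all times: passing to \<open>Suc k\<close> adds the constraint on
  \<open>innovation k\<close>.\<close>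

definition rectangle :: "(nat \<Rightarrow> 'p \<Rightarrow> real set) \<Rightarrow> nat \<Rightarrow> 'a set" where
  "rectangle B k = {\<omega> \<in> space M. \<forall>i<k. \<forall>j. innovation i \<omega> $ j \<in> B i j}"

lemma rectangle_sets:
  assumes [measurable]: "\<And>i j. B i j \<in> sets borel"
    and [measurable]: "\<And>i. i < k \<Longrightarrow> innovation i \<in> borel_measurable N" and "space N = space M"
  shows "rectangle B k \<in> sets N"
proof -
  have "rectangle B k = {\<omega> \<in> space N. \<forall>i\<in>{..<k}. \<forall>j. innovation i \<omega> $ j \<in> B i j}"
    by (auto simp: rectangle_def assms(3))
  also have "\<dots> \<in> sets N"
  proof (intro sets.sets_Collect_finite_All)
    fix i assume "i \<in> {..<k}"
    then have "innovation i \<in> borel_measurable N" using assms(2) by simp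
    then have "(\<lambda>\<omega>. innovation i \<omega> $ j) \<in> borel_measurable N" for j
      by (rule measurable_compose) simp
    then show "{\<omega> \<in> space N. \<forall>j. innovation i \<omega> $ j \<in> B i j} \<in> sets N"
      by (intro sets.sets_Collect_countable_All) measurable
  qed simp
  finally show ?thesis .
qed

lemma rectangle_events [measurable]:
  assumes "\<And>i j. B i j \<in> sets borel"
  shows "rectangle B k \<in> events"
  using assms innovation_measurable by (rule rectangle_sets) simp

lemma rectangle_past:
  assumes "\<And>i j. B i j \<in> sets borel"
  shows "rectangle B k \<in> sets (past k)"
proof (rule rectangle_sets[OF assms])
  fix i assume i: "i < k"
  have [measurable]: "v i \<in> borel_measurable (past k)"
    using i by (intro source_measurable_past[of "Measurement_Noise i"])
      (auto simp: past_sources_def source_sets_def)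
  have [measurable]: "e i \<in> borel_measurable (past k)"
    using error_measurable_past less_imp_le[OF i] by (rule measurable_past_mono)
  show "innovation i \<in> borel_measurable (past k)"
    unfolding innovation_def[abs_def] by measurable
qed simp

text \<open>An unnormalized way to say that \<open>e k\<close> given the rectangle has law N(0,
  \<open>P k\<close>), valid for null rectangles too. In the step, \<open>joint\<close> decouples
  \<open>e (Suc k)\<close> from \<open>innovation k\<close> on the old rectangle, and Fourier
  uniqueness adds the new constraint.\<close>

lemma char_error_rectangle:
  assumes B [measurable]: "\<And>i j. B i j \<in> sets borel"
  shows "(CLINT \<omega>|M. indicator (rectangle B k) \<omega> * iexp (a \<bullet> e k \<omega>))
    = prob (rectangle B k) * exp (- (a \<bullet> (P k *v a)) / 2)"
proof (induction k arbitrary: a)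
  case 0
  have "(CLINT \<omega>|M. indicator (rectangle B 0) \<omega> * iexp (a \<bullet> e 0 \<omega>)) = (CLINT \<omega>|M. iexp (a \<bullet> e 0 \<omega>))"
    by (intro Bochner_Integration.integral_cong) (auto simp: rectangle_def)
  then show ?case
    by (simp add: char_initial rectangle_def prob_space)
next
  case (Suc k)
  let ?G = "rectangle B k"
  have joint: "(CLINT \<omega>|M. indicator ?G \<omega> * iexp (a \<bullet> e (Suc k) \<omega>) * iexp (b \<bullet> innovation k \<omega>))
    = prob ?G * exp (- (a \<bullet> (P (Suc k) *v a)) / 2) * exp (- (b \<bullet> (S k *v b)) / 2)" for a b
  proof -
    \<comment> \<open>\<beta> and \<alpha> are the coefficients of \<open>v k\<close> and
      \<open>e k\<close> once the recursion for \<open>e (Suc k)\<close> is substituted.\<close>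
    define \<beta> where "\<beta> = b - transpose (K k) *v a"
    define \<alpha> where "\<alpha> = transpose (A k) *v a + transpose (C k) *v \<beta>"
    have split: "a \<bullet> e (Suc k) \<omega> + b \<bullet> innovation k \<omega> = \<alpha> \<bullet> e k \<omega> + a \<bullet> w k \<omega> + \<beta> \<bullet> v k \<omega>"
      if "\<omega> \<in> space M" for \<omega>
    proof -
      have "a \<bullet> e (Suc k) \<omega> + b \<bullet> innovation k \<omega>
        = (transpose (A k) *v a) \<bullet> e k \<omega> + a \<bullet> w k \<omega> + \<beta> \<bullet> innovation k \<omega>"
        using step[OF that, of k]
        by (simp add: \<beta>_def innovation_def inner_add_right inner_diff_right inner_diff_left
            inner_matrix_vector_mult[of a] del: transpose_matrix_vector)
      also have "\<beta> \<bullet> innovation k \<omega> = (transpose (C k) *v \<beta>) \<bullet> e k \<omega> + \<beta> \<bullet> v k \<omega>"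
        by (simp add: innovation_def inner_add_right inner_matrix_vector_mult[of \<beta>]
            del: transpose_matrix_vector)
      finally show ?thesis by (simp add: \<alpha>_def inner_add_left)
    qed
    define f where "f \<omega> = indicator ?G \<omega> * iexp (\<alpha> \<bullet> e k \<omega>)" for \<omega>
    have "(CLINT \<omega>|M. indicator ?G \<omega> * iexp (a \<bullet> e (Suc k) \<omega>) * iexp (b \<bullet> innovation k \<omega>))
      = (CLINT \<omega>|M. f \<omega> * iexp (a \<bullet> w k \<omega>) * iexp (\<beta> \<bullet> v k \<omega>))"
    proof (intro Bochner_Integration.integral_cong refl)
      fix \<omega> assume "\<omega> \<in> space M"
      then have "iexp (a \<bullet> e (Suc k) \<omega>) * iexp (b \<bullet> innovation k \<omega>)
        = iexp (\<alpha> \<bullet> e k \<omega>) * iexp (a \<bullet> w k \<omega>) * iexp (\<beta> \<bullet> v k \<omega>)"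
        unfolding exp_add[symmetric] distrib_left[symmetric] of_real_add[symmetric]
        by (simp only: split)
      then show "indicator ?G \<omega> * iexp (a \<bullet> e (Suc k) \<omega>) * iexp (b \<bullet> innovation k \<omega>)
        = f \<omega> * iexp (a \<bullet> w k \<omega>) * iexp (\<beta> \<bullet> v k \<omega>)"
        by (simp add: f_def mult.assoc)
    qed
    also have "\<dots> = (CLINT \<omega>|M. f \<omega>) * exp (- (a \<bullet> (Q k *v a)) / 2) * exp (- (\<beta> \<bullet> (R k *v \<beta>)) / 2)"
    proof (rule expectation_past_mult)
      have [measurable]: "?G \<in> sets (past k)" "e k \<in> borel_measurable (past k)"
        using rectangle_past[OF B] error_measurable_past by auto
      show "f \<in> borel_measurable (past k)" unfolding f_def by measurable
      show "cmod (f \<omega>) \<le> 1" for \<omega> by (simp add: f_def norm_mult indicator_def)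
    qed
    \<comment> \<open>The induction hypothesis is used at \<alpha>, so it has to hold for arbitrary
      vectors.\<close>
    also have "(CLINT \<omega>|M. f \<omega>) = prob ?G * exp (- (\<alpha> \<bullet> (P k *v \<alpha>)) / 2)"
      unfolding f_def by (rule Suc.IH)
    finally have "(CLINT \<omega>|M. indicator ?G \<omega> * iexp (a \<bullet> e (Suc k) \<omega>) * iexp (b \<bullet> innovation k \<omega>))
      = complex_of_real (prob ?G * exp (- (\<alpha> \<bullet> (P k *v \<alpha>) + a \<bullet> (Q k *v a) + \<beta> \<bullet> (R k *v \<beta>)) / 2))"
      by (simp only: minus_add_distrib add_divide_distrib exp_add of_real_mult mult.assoc)
    \<comment> \<open>The quadratic form identity replaces the three exponents by one in
      \<open>a\<close> and one in \<open>b\<close>, with no mixed term.\<close>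
    then show ?thesis
      unfolding riccati_quadratic_form[OF symmetric_P symmetric_R S invertible_S K riccati \<beta>_def \<alpha>_def]
      by (simp only: minus_add_distrib add_divide_distrib exp_add of_real_mult mult.assoc)
  qed
  define c where "c = exp (- (a \<bullet> (P (Suc k) *v a)) / 2)"
  \<comment> \<open>The deviation of the exponential from its expected conditional value
    \<open>c\<close>, on the old rectangle. Its transform in the innovation is \<open>joint\<close>
    at \<open>a\<close> minus \<open>c\<close> times \<open>joint\<close> at \<open>0\<close>, hence
    zero.\<close>
  define W where "W \<omega> = indicator ?G \<omega> * (iexp (a \<bullet> e (Suc k) \<omega>) - c)" for \<omega>
  have int: "integrable M (\<lambda>\<omega>. indicator G \<omega> * iexp (a \<bullet> e (Suc k) \<omega>) * iexp (g \<omega>))"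
    if [measurable]: "G \<in> events" "g \<in> borel_measurable M" for a g G
    by (rule integrable_bounded[of _ 1]) (auto simp: norm_mult indicator_def)
  have G' [measurable]: "rectangle B (Suc k) \<in> events" using B by (rule rectangle_events)
  have "(CLINT \<omega>|M. W \<omega> * (\<Prod>j\<in>UNIV. indicator (B k j) (innovation k \<omega> $ j))) = 0"
  proof (rule fourier_unique_rectangle)
    show "cmod (W \<omega>) \<le> 1 + \<bar>c\<bar>" for \<omega>
      using norm_triangle_ineq4[of "iexp (a \<bullet> e (Suc k) \<omega>)" c]
      by (simp add: W_def norm_mult indicator_def)
    show "W \<in> borel_measurable M"
      unfolding W_def using rectangle_events[of B k] by measurable
    fix b :: "'p \<Rightarrow> real"
    let ?b = "\<chi> j. b j"
    have eq: "(\<Sum>j\<in>UNIV. b j * innovation k \<omega> $ j) = ?b \<bullet> innovation k \<omega>" for \<omega>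
      by (simp add: inner_vec_def)
    \<comment> \<open>The factor with \<open>0 \<bullet> e (Suc k) \<omega>\<close> is the constant
      1, inserted to give the second term the shape of \<open>joint\<close>.\<close>
    have "(CLINT \<omega>|M. W \<omega> * iexp (?b \<bullet> innovation k \<omega>))
      = (CLINT \<omega>|M. indicator ?G \<omega> * iexp (a \<bullet> e (Suc k) \<omega>) * iexp (?b \<bullet> innovation k \<omega>)
          - c * (indicator ?G \<omega> * iexp (0 \<bullet> e (Suc k) \<omega>) * iexp (?b \<bullet> innovation k \<omega>)))"
      by (intro Bochner_Integration.integral_cong) (auto simp: W_def algebra_simps)
    also have "\<dots> = (CLINT \<omega>|M. indicator ?G \<omega> * iexp (a \<bullet> e (Suc k) \<omega>) * iexp (?b \<bullet> innovation k \<omega>))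
          - c * (CLINT \<omega>|M. indicator ?G \<omega> * iexp (0 \<bullet> e (Suc k) \<omega>) * iexp (?b \<bullet> innovation k \<omega>))"
      using rectangle_events[of B k]
      by (subst Bochner_Integration.integral_diff) (auto intro!: int simp del: inner_zero_left)
    also have "\<dots> = 0"
      unfolding joint by (simp add: c_def)
    finally show "(CLINT \<omega>|M. W \<omega> * iexp (\<Sum>j\<in>UNIV. b j * innovation k \<omega> $ j)) = 0"
      unfolding eq .
  qed (auto simp: B intro: measurable_compose[OF innovation_measurable])
  \<comment> \<open>The indicators for time \<open>k\<close> cut the old rectangle down to the one
    for \<open>Suc k\<close>.\<close>
  also have "(CLINT \<omega>|M. W \<omega> * (\<Prod>j\<in>UNIV. indicator (B k j) (innovation k \<omega> $ j)))
    = (CLINT \<omega>|M. indicator (rectangle B (Suc k)) \<omega> * iexp (a \<bullet> e (Suc k) \<omega>)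
        - c * indicator (rectangle B (Suc k)) \<omega>)"
  proof (intro Bochner_Integration.integral_cong refl)
    fix \<omega>
    have prod: "(\<Prod>j\<in>UNIV. indicator (B k j) (innovation k \<omega> $ j))
      = (if \<forall>j. innovation k \<omega> $ j \<in> B k j then 1 else 0 :: complex)"
      by (auto simp: indicator_def)
    show "W \<omega> * (\<Prod>j\<in>UNIV. indicator (B k j) (innovation k \<omega> $ j))
      = indicator (rectangle B (Suc k)) \<omega> * iexp (a \<bullet> e (Suc k) \<omega>)
        - c * indicator (rectangle B (Suc k)) \<omega>"
      unfolding W_def prod by (auto simp: rectangle_def less_Suc_eq indicator_def)
  qed
  also have "\<dots> = (CLINT \<omega>|M. indicator (rectangle B (Suc k)) \<omega> * iexp (a \<bullet> e (Suc k) \<omega>))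
      - c * prob (rectangle B (Suc k))"
  proof -
    have "integrable M (\<lambda>\<omega>. complex_of_real c * complex_of_real (indicator (rectangle B (Suc k)) \<omega>))"
      by (rule integrable_bounded[of _ "\<bar>c\<bar>"]) (auto simp: norm_mult indicator_def)
    then show ?thesis
      using int[of "rectangle B (Suc k)" "\<lambda>_. 0" a]
      by (subst Bochner_Integration.integral_diff) auto
  qed
  finally show ?case
    by (simp add: c_def mult.commute)
qed

section \<open>Conditional moments given the innovations\<close>

text \<open>Rectangles are stable under intersection, so integral identities checked on these
  generators extend to the whole algebra.\<close>

definition innovation_algebra :: "nat \<Rightarrow> 'a measure" where
  "innovation_algebra k = sigma (space M) {rectangle B k |B. \<forall>i j. B i j \<in> sets borel}"

lemma space_innovation_algebra [simp]: "space (innovation_algebra k) = space M"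
  unfolding innovation_algebra_def by (rule space_measure_of_conv)

lemma sets_innovation_algebra:
  "sets (innovation_algebra k) = sigma_sets (space M) {rectangle B k |B. \<forall>i j. B i j \<in> sets borel}"
  unfolding innovation_algebra_def by (rule sets_measure_of) (auto simp: rectangle_def)

lemma innovation_measurable_algebra:
  assumes "i < k"
  shows "innovation i \<in> borel_measurable (innovation_algebra k)"
proof -
  have "(\<lambda>\<omega>. innovation i \<omega> $ j) \<in> borel_measurable (innovation_algebra k)" for j
  proof (rule measurableI)
    fix B :: "real set" assume B: "B \<in> sets borel"
    \<comment> \<open>Every coordinate is left free except component \<open>j\<close> of innovation
      \<open>i\<close>; since \<open>i < k\<close>, the preimage is a rectangle.\<close>
    define B' where "B' i' j' = (if i' = i \<and> j' = j then B else UNIV)" for i' :: nat and j' :: 'p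
    have "(\<lambda>\<omega>. innovation i \<omega> $ j) -` B \<inter> space (innovation_algebra k) = rectangle B' k"
      using assms by (auto simp: rectangle_def B'_def)
    also have "\<dots> \<in> sets (innovation_algebra k)"
      unfolding sets_innovation_algebra using B by (intro sigma_sets.Basic) (auto simp: B'_def)
    finally show "(\<lambda>\<omega>. innovation i \<omega> $ j) -` B \<inter> space (innovation_algebra k) \<in> sets (innovation_algebra k)" .
  qed simp
  then show ?thesis
    by (subst borel_measurable_euclidean_space) (auto simp: Basis_vec_def inner_axis)
qed

text \<open>Rectangles give the moments of all functionals of the error, polarization turns these
  into entries, and the pi-lambda argument extends the identities to all innovation events.\<close>

lemma error_moments:
  "integrable M (\<lambda>\<omega>. e k \<omega> $ i)" "integrable M (\<lambda>\<omega>. e k \<omega> $ i * e k \<omega> $ j)"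
  and error_moments_innovation:
  "F \<in> sets (innovation_algebra k) \<Longrightarrow> (\<integral>\<omega>. indicator F \<omega> * e k \<omega> $ i \<partial>M) = 0"
  "F \<in> sets (innovation_algebra k) \<Longrightarrow>
    (\<integral>\<omega>. indicator F \<omega> * (e k \<omega> $ i * e k \<omega> $ j - P k $ i $ j) \<partial>M) = 0"
proof -
  let ?\<G> = "{rectangle B k |B. \<forall>i j. B i j \<in> sets borel}"
  \<comment> \<open>Scaling \<open>a\<close> by \<open>t\<close> brings the vector formula into
    scalar form with variance \<open>a \<bullet> (P k *v a)\<close>.\<close>
  have char: "(CLINT \<omega>|M. indicator (rectangle B k) \<omega> * iexp (t * (a \<bullet> e k \<omega>)))
    = prob (rectangle B k) * exp (- (a \<bullet> (P k *v a) * t\<^sup>2) / 2)"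
    if "\<And>i j. B i j \<in> sets borel" for B a t
    using char_error_rectangle[of B k "t *\<^sub>R a", OF that]
    by (simp add: matrix_vector_mult_scaleR power2_eq_square mult_ac)
  \<comment> \<open>The whole space is the rectangle with all ranges \<open>UNIV\<close>; this
    unconditional version yields integrability.\<close>
  have char1: "(CLINT \<omega>|M. iexp (t * (a \<bullet> e k \<omega>))) = exp (- (a \<bullet> (P k *v a) * t\<^sup>2) / 2)" for a t
  proof -
    have full: "rectangle (\<lambda>_ _. UNIV) k = space M" by (simp add: rectangle_def)
    have "(CLINT \<omega>|M. iexp (t * (a \<bullet> e k \<omega>))) = (CLINT \<omega>|M. indicator (space M) \<omega> * iexp (t * (a \<bullet> e k \<omega>)))"
      by (intro Bochner_Integration.integral_cong) auto
    then show ?thesis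
      using char[of "\<lambda>_ _. UNIV" t a] by (simp add: full prob_space)
  qed
  have m [measurable]: "(\<lambda>\<omega>. a \<bullet> e k \<omega>) \<in> borel_measurable M" for a by measurable
  have ia: "integrable M (\<lambda>\<omega>. a \<bullet> e k \<omega>)" for a
    by (rule gaussian_char_moments(1)[OF m char1])
  have ia2: "integrable M (\<lambda>\<omega>. (a \<bullet> e k \<omega>)\<^sup>2)" for a
    by (rule gaussian_char_moments(2)[OF m char1])
  show i1: "integrable M (\<lambda>\<omega>. e k \<omega> $ i)" for i
    using ia[of "axis i 1"] by (simp add: inner_axis')
  show i2: "integrable M (\<lambda>\<omega>. e k \<omega> $ i * e k \<omega> $ j)" for i j
    using ia2 by (rule integrable_component_mult)
  have G1: "(\<integral>\<omega>. indicator G \<omega> * (a \<bullet> e k \<omega>) \<partial>M) = 0"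
    and G2: "(\<integral>\<omega>. indicator G \<omega> * (a \<bullet> e k \<omega>)\<^sup>2 \<partial>M) = prob G * (a \<bullet> (P k *v a))"
    if G: "G \<in> ?\<G>" for G a
  proof -
    obtain B where B: "G = rectangle B k" "\<And>i j. B i j \<in> sets borel" using G by auto
    have "G \<in> events" using rectangle_events[OF B(2)] B(1) by simp
    note * = gaussian_char_moments_on[OF m this, of a "a \<bullet> (P k *v a)"]
    show "(\<integral>\<omega>. indicator G \<omega> * (a \<bullet> e k \<omega>) \<partial>M) = 0"
      "(\<integral>\<omega>. indicator G \<omega> * (a \<bullet> e k \<omega>)\<^sup>2 \<partial>M) = prob G * (a \<bullet> (P k *v a))"
      using * char[OF B(2)] by (auto simp: B(1))
  qed
  have \<G>: "Int_stable ?\<G>" "?\<G> \<subseteq> events" "space M \<in> ?\<G>"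
  proof -
    show "Int_stable ?\<G>"
    proof (rule Int_stableI)
      fix a b assume "a \<in> ?\<G>" "b \<in> ?\<G>"
      then obtain B B' where B: "a = rectangle B k" "b = rectangle B' k"
        "\<forall>i j. B i j \<in> sets borel" "\<forall>i j. B' i j \<in> sets borel" by auto
      have "a \<inter> b = rectangle (\<lambda>i j. B i j \<inter> B' i j) k" by (auto simp: B rectangle_def)
      with B show "a \<inter> b \<in> ?\<G>" by (auto intro!: exI[of _ "\<lambda>i j. B i j \<inter> B' i j"])
    qed
    show "?\<G> \<subseteq> events" by (auto intro!: rectangle_events)
    show "space M \<in> ?\<G>" by (auto simp: rectangle_def intro!: exI[of _ "\<lambda>_ _. UNIV"])
  qed
  assume "F \<in> sets (innovation_algebra k)"
  then have F: "F \<in> sigma_sets (space M) ?\<G>" by (simp only: sets_innovation_algebra)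
  show "(\<integral>\<omega>. indicator F \<omega> * e k \<omega> $ i \<partial>M) = 0"
    using i1 \<G> _ F by (rule integral_zero_sigma_sets) (use G1[of _ "axis i 1"] in \<open>simp add: inner_axis'\<close>)
  show "(\<integral>\<omega>. indicator F \<omega> * (e k \<omega> $ i * e k \<omega> $ j - P k $ i $ j) \<partial>M) = 0"
  proof (rule integral_zero_sigma_sets[OF _ \<G> _ F])
    show "integrable M (\<lambda>\<omega>. e k \<omega> $ i * e k \<omega> $ j - P k $ i $ j)" using i2 by simp
    fix G assume G: "G \<in> ?\<G>"
    have iG: "integrable M (\<lambda>\<omega>. indicator G \<omega> * f \<omega>)" if "integrable M f" for f :: "'a \<Rightarrow> real"
      using integrable_mult_indicator[OF subsetD[OF \<G>(2) G] that] by simp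
    have e2: "(\<integral>\<omega>. indicator G \<omega> * (e k \<omega> $ i)\<^sup>2 \<partial>M) = prob G * P k $ i $ i" for i
      using G2[OF G, of "axis i 1"] by (simp add: inner_axis' matrix_vector_mult_basis column_def)
    have Pij: "P k $ j $ i = P k $ i $ j"
      using arg_cong[OF symmetric_P[of k], of "\<lambda>N. N $ i $ j"] by (simp add: transpose_def)
    have i2': "integrable M (\<lambda>\<omega>. indicator G \<omega> * (e k \<omega> $ i)\<^sup>2)" for i
      using iG[OF i2[of i i]] by (simp add: power2_eq_square)
    \<comment> \<open>The second moment of the sum of two coordinates, with both diagonal moments
      known, isolates the mixed one; symmetry of \<open>P k\<close> merges the two off-diagonal
      entries.\<close>
    have "prob G * (P k $ i $ i + 2 * P k $ i $ j + P k $ j $ j)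
      = (\<integral>\<omega>. indicator G \<omega> * ((axis i 1 + axis j 1) \<bullet> e k \<omega>)\<^sup>2 \<partial>M)"
      unfolding G2[OF G]
      by (simp add: inner_axis' matrix_vector_right_distrib inner_add_left matrix_vector_mult_basis
          column_def Pij)
    also have "\<dots> = (\<integral>\<omega>. indicator G \<omega> * (e k \<omega> $ i)\<^sup>2 + 2 * (indicator G \<omega> * (e k \<omega> $ i * e k \<omega> $ j))
        + indicator G \<omega> * (e k \<omega> $ j)\<^sup>2 \<partial>M)"
      unfolding inner_axis_sum_power2
      by (intro Bochner_Integration.integral_cong) (simp_all add: algebra_simps)
    also have "\<dots> = prob G * P k $ i $ i
        + 2 * (\<integral>\<omega>. indicator G \<omega> * (e k \<omega> $ i * e k \<omega> $ j) \<partial>M) + prob G * P k $ j $ j"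
      using i2' iG[OF i2[of i j]] by (simp add: e2)
    finally have "(\<integral>\<omega>. indicator G \<omega> * (e k \<omega> $ i * e k \<omega> $ j) \<partial>M) = prob G * P k $ i $ j"
      by (simp add: algebra_simps)
    moreover have "(\<integral>\<omega>. indicator G \<omega> * (e k \<omega> $ i * e k \<omega> $ j - P k $ i $ j) \<partial>M)
      = (\<integral>\<omega>. indicator G \<omega> * (e k \<omega> $ i * e k \<omega> $ j) - indicator G \<omega> * P k $ i $ j \<partial>M)"
      by (simp add: algebra_simps)
    moreover have "\<dots> = (\<integral>\<omega>. indicator G \<omega> * (e k \<omega> $ i * e k \<omega> $ j) \<partial>M) - prob G * P k $ i $ j"
      using iG[OF i2[of i j]] integrable_indicator_events[OF subsetD[OF \<G>(2) G]] subsetD[OF \<G>(2) G]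
      by (subst Bochner_Integration.integral_diff) auto
    ultimately show "(\<integral>\<omega>. indicator G \<omega> * (e k \<omega> $ i * e k \<omega> $ j - P k $ i $ j) \<partial>M) = 0"
      by simp
  qed
qed

text \<open>Zero and \<open>P k\<close> are constants, hence measurable for every subalgebra, and a
  smaller algebra inherits the integral identities. Allowing any such \<open>N\<close> covers the
  algebra generated by the estimate.\<close>

lemma error_conditional_moments:
  assumes N: "subalgebra M N" "sets N \<subseteq> sets (innovation_algebra k)"
  shows "AE \<omega> in M. vec_cond_exp M N (e k) \<omega> = 0"
    and "AE \<omega> in M. cond_cov M N (e k) \<omega> = P k"
proof -
  interpret finite_measure_subalgebra M N
    using N(1) by unfold_locales
  have mean: "AE \<omega> in M. real_cond_exp M N (\<lambda>\<omega>. e k \<omega> $ i) \<omega> = 0" for i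
  proof (rule real_cond_exp_charact)
    fix F assume "F \<in> sets N"
    then show "(LINT \<omega>:F|M. e k \<omega> $ i) = (LINT \<omega>:F|M. 0)"
      using error_moments_innovation(1)[of F k i] N(2) by (auto simp: set_lebesgue_integral_def)
  qed (use error_moments(1) in auto)
  show mean': "AE \<omega> in M. vec_cond_exp M N (e k) \<omega> = 0"
    using AE_finite_allI[OF finite_class.finite_UNIV mean] by (simp add: vec_cond_exp_def vec_eq_iff)
  have [measurable]: "vec_cond_exp M N (e k) \<in> borel_measurable M"
    unfolding vec_cond_exp_def[abs_def]
    by (subst borel_measurable_euclidean_space) (auto simp: Basis_vec_def inner_axis)
  have [measurable]: "(\<lambda>\<omega>. e k \<omega> $ i) \<in> borel_measurable M"
    "(\<lambda>\<omega>. vec_cond_exp M N (e k) \<omega> $ i) \<in> borel_measurable M" for i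
    by (rule measurable_compose[OF _ borel_measurable_nth], measurable)+
  have cov: "AE \<omega> in M. real_cond_exp M N
    (\<lambda>\<omega>. outer (e k \<omega> - vec_cond_exp M N (e k) \<omega>) (e k \<omega> - vec_cond_exp M N (e k) \<omega>) $ i $ j) \<omega>
      = P k $ i $ j" (is "AE \<omega> in M. real_cond_exp M N ?g \<omega> = _") for i j
  proof -
    \<comment> \<open>As the conditional mean vanishes almost everywhere, centring by it changes the
      products only on a null set.\<close>
    have "AE \<omega> in M. real_cond_exp M N ?g \<omega> = real_cond_exp M N (\<lambda>\<omega>. e k \<omega> $ i * e k \<omega> $ j) \<omega>"
    proof (rule real_cond_exp_cong)
      show "AE \<omega> in M. ?g \<omega> = e k \<omega> $ i * e k \<omega> $ j"
        using mean' by eventually_elim (simp add: outer_def)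
    qed (simp_all add: outer_def)
    moreover have "AE \<omega> in M. real_cond_exp M N (\<lambda>\<omega>. e k \<omega> $ i * e k \<omega> $ j) \<omega> = P k $ i $ j"
    proof (rule real_cond_exp_charact)
      fix F assume F: "F \<in> sets N"
      then have FM: "F \<in> events" using N(1) by (auto simp: subalgebra_def)
      have "(\<integral>\<omega>. indicator F \<omega> * (e k \<omega> $ i * e k \<omega> $ j) - indicator F \<omega> * P k $ i $ j \<partial>M) = 0"
        using error_moments_innovation(2)[of F k i j] F N(2) by (auto simp: algebra_simps)
      then show "(LINT \<omega>:F|M. e k \<omega> $ i * e k \<omega> $ j) = (LINT \<omega>:F|M. P k $ i $ j)"
        using integrable_mult_indicator[OF FM error_moments(2)[of k i j]]
          integrable_indicator_events[OF FM] FM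
        by (subst (asm) Bochner_Integration.integral_diff) (auto simp: set_lebesgue_integral_def)
    qed (use error_moments(2) in auto)
    ultimately show ?thesis by eventually_elim simp
  qed
  have "AE \<omega> in M. \<forall>i j. real_cond_exp M N
    (\<lambda>\<omega>. outer (e k \<omega> - vec_cond_exp M N (e k) \<omega>) (e k \<omega> - vec_cond_exp M N (e k) \<omega>) $ i $ j) \<omega>
      = P k $ i $ j"
    using AE_finite_allI[OF finite_class.finite_UNIV AE_finite_allI[OF finite_class.finite_UNIV cov]] by simp
  then show "AE \<omega> in M. cond_cov M N (e k) \<omega> = P k"
    by eventually_elim (simp add: cond_cov_def mat_cond_exp_def vec_eq_iff)
qed

end

section \<open>Application to the system with inputs and its filter\<close>

theorem lemma5:
  fixes M :: "'a measure"
    and x xh w :: "nat \<Rightarrow> 'a \<Rightarrow> real ^ 'n"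
    and u :: "nat \<Rightarrow> 'a \<Rightarrow> real ^ 'm"
    and y v :: "nat \<Rightarrow> 'a \<Rightarrow> real ^ 'p"
    and A P Q :: "nat \<Rightarrow> real ^ 'n ^ 'n"
    and B :: "nat \<Rightarrow> real ^ 'm ^ 'n"
    and C :: "nat \<Rightarrow> real ^ 'n ^ 'p"
    and R :: "nat \<Rightarrow> real ^ 'p ^ 'p"
    and K :: "nat \<Rightarrow> real ^ 'p ^ 'n"
  assumes "prob_space M"
    and state: "\<And>k \<omega>. \<omega> \<in> space M \<Longrightarrow> x (Suc k) \<omega> = A k *v x k \<omega> + B k *v u k \<omega> + w k \<omega>"
    and measurement: "\<And>k \<omega>. \<omega> \<in> space M \<Longrightarrow> y k \<omega> = C k *v x k \<omega> + v k \<omega>"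
    and input: "\<And>k. u k \<in> borel_measurable (history_algebra M y k)"
    and initial_gaussian: "gaussian_vector M (x 0)"
    and w_gaussian: "\<And>k. gaussian_vector M (w k)"
    and v_gaussian: "\<And>k. gaussian_vector M (v k)"
    and independent: "independent_sources M (x 0) w v"
    and w_zero_mean: "\<And>k. (\<integral>\<omega>. w k \<omega> \<partial>M) = 0"
    and v_zero_mean: "\<And>k. (\<integral>\<omega>. v k \<omega> \<partial>M) = 0"
    and w_second_moment: "\<And>k. integrable M (\<lambda>\<omega>. (norm (w k \<omega>))\<^sup>2)"
    and v_second_moment: "\<And>k. integrable M (\<lambda>\<omega>. (norm (v k \<omega>))\<^sup>2)"
    and Q: "\<And>k. Q k = second_moment M (w k)"
    and R: "\<And>k. R k = second_moment M (v k)"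
    and filter_initial: "\<And>\<omega>. \<omega> \<in> space M \<Longrightarrow> xh 0 \<omega> = (\<integral>\<omega>'. x 0 \<omega>' \<partial>M)"
    and filter_step: "\<And>k \<omega>. \<omega> \<in> space M \<Longrightarrow>
      xh (Suc k) \<omega> = A k *v xh k \<omega> + B k *v u k \<omega> + K k *v (y k \<omega> - C k *v xh k \<omega>)"
    and gain: "\<And>k. K k =
      A k ** P k ** transpose (C k) ** matrix_inv (C k ** P k ** transpose (C k) + R k)"
    and innovation_invertible: "\<And>k. invertible (C k ** P k ** transpose (C k) + R k)"
    and riccati_initial: "P 0 = second_moment M (\<lambda>\<omega>. x 0 \<omega> - xh 0 \<omega>)"
    and riccati_step: "\<And>k. P (Suc k) =
      A k ** P k ** transpose (A k) + Q k
      - A k ** P k ** transpose (C k) ** matrix_inv (C k ** P k ** transpose (C k) + R k)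
          ** C k ** P k ** transpose (A k)"
  shows "\<forall>k. (AE \<omega> in M. vec_cond_exp M (rv_algebra M (xh k)) (\<lambda>\<omega>'. x k \<omega>' - xh k \<omega>') \<omega> = 0)
           \<and> (AE \<omega> in M. cond_cov M (rv_algebra M (xh k)) (\<lambda>\<omega>'. x k \<omega>' - xh k \<omega>') \<omega> = P k)"
proof -
  interpret prob_space M by fact
  define e where "e k \<omega> = x k \<omega> - xh k \<omega>" for k \<omega>
  have [measurable]: "x 0 \<in> borel_measurable M"
    "w k \<in> borel_measurable M" "v k \<in> borel_measurable M" for k
    using initial_gaussian w_gaussian v_gaussian by (auto simp: gaussian_vector_def)
  have e0: "e 0 \<omega> = x 0 \<omega> - expectation (x 0)" if "\<omega> \<in> space M" for \<omega>
    using filter_initial[OF that] by (simp add: e_def)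
  have e0_measurable: "e 0 \<in> borel_measurable N"
    if [measurable]: "x 0 \<in> borel_measurable N" and "space N = space M" for N
    using e0 that(2) by (subst measurable_cong[of _ _ "\<lambda>\<omega>. x 0 \<omega> - expectation (x 0)"]) auto
  have P0: "P 0 = second_moment M (\<lambda>\<omega>. x 0 \<omega> - expectation (x 0))"
    unfolding riccati_initial second_moment_def
    by (simp add: filter_initial cong: Bochner_Integration.integral_cong)
  \<comment> \<open>\<open>e 0\<close> is \<open>x 0\<close> shifted by a constant, so its algebra
    is no larger and independence of the sources is inherited.\<close>
  have "sets (rv_algebra M (e 0)) \<subseteq> sets (rv_algebra M (x 0))"
    by (intro sets_rv_algebra_subset e0_measurable rv_algebra_measurable) (simp_all add: rv_algebra_def)
  then have indep: "independent_sources M (e 0) w v"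
    using independent unfolding independent_sources_def
    by (elim indep_sets_mono_sets) (auto split: source.split)
  interpret E: kalman_error M e w v A P Q C R "\<lambda>k. C k ** P k ** transpose (C k) + R k" K
  proof
    \<comment> \<open>The same input term stands in the state and filter equations and cancels in
      the difference, whatever feedback produced it.\<close>
    show "e (Suc k) \<omega> = A k *v e k \<omega> + w k \<omega> - K k *v (C k *v e k \<omega> + v k \<omega>)"
      if "\<omega> \<in> space M" for k \<omega>
      using state[OF that, of k] filter_step[OF that, of k] measurement[OF that, of k]
      by (simp add: e_def algebra_simps)
    show "e 0 \<in> borel_measurable M" by (rule e0_measurable) simp_all
    show "(CLINT \<omega>|M. iexp (a \<bullet> e 0 \<omega>)) = exp (- (a \<bullet> (P 0 *v a)) / 2)" for a
      unfolding P0 gaussian_vector_char[OF initial_gaussian, symmetric]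
      by (intro Bochner_Integration.integral_cong) (auto simp: e0)
    show "(CLINT \<omega>|M. iexp (a \<bullet> w k \<omega>)) = exp (- (a \<bullet> (Q k *v a)) / 2)" for k a
      using gaussian_vector_char[OF w_gaussian, of a k] by (simp add: w_zero_mean Q)
    show "(CLINT \<omega>|M. iexp (a \<bullet> v k \<omega>)) = exp (- (a \<bullet> (R k *v a)) / 2)" for k a
      using gaussian_vector_char[OF v_gaussian, of a k] by (simp add: v_zero_mean R)
  qed (simp_all add: indep P0 Q R transpose_second_moment gain riccati_step
      innovation_invertible[unfolded R])
  have innov: "y k \<omega> = E.innovation k \<omega> + C k *v xh k \<omega>" if "\<omega> \<in> space M" for k \<omega>
    using measurement[OF that, of k]
    by (simp add: E.innovation_def e_def matrix_vector_mult_diff_distrib)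
  \<comment> \<open>Strong induction is needed because the input at time \<open>j\<close> may depend
    on \<open>y 0\<close> up to \<open>y j\<close>. Each of these is recovered from its innovation
    and the estimate at the same time, which precedes \<open>xh (Suc j)\<close>.\<close>
  have estimate: "xh i \<in> borel_measurable (E.innovation_algebra k)" if "i \<le> k" for i k
    using that
  proof (induction i rule: less_induct)
    case (less i)
    let ?F = "E.innovation_algebra k"
    have y [measurable]: "y j \<in> borel_measurable ?F" if "j < i" for j
    proof -
      have [measurable]: "E.innovation j \<in> borel_measurable ?F" "xh j \<in> borel_measurable ?F"
        using that less by (auto intro: E.innovation_measurable_algebra)
      show ?thesis
        by (subst measurable_cong[of _ _ "\<lambda>\<omega>. E.innovation j \<omega> + C j *v xh j \<omega>"])
          (auto simp: innov)
    qed
    show ?case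
    proof (cases i)
      case 0
      then show ?thesis
        by (subst measurable_cong[of _ _ "\<lambda>\<omega>. expectation (x 0)"]) (auto simp: filter_initial)
    next
      case (Suc j)
      have [measurable]: "y j \<in> borel_measurable ?F" "xh j \<in> borel_measurable ?F"
        using y less Suc by auto
      have "(\<lambda>\<omega>. \<lambda>l\<in>{..j}. y l \<omega>) \<in> measurable ?F (\<Pi>\<^sub>M l\<in>{..j}. borel)"
        using y Suc by (intro measurable_restrict) auto
      \<comment> \<open>The measurement history is a measurable map on \<open>?F\<close>, so the
        identity into the algebra it generates is measurable; composing with it transfers
        measurability of the input to \<open>?F\<close>.\<close>
      then have "(\<lambda>\<omega>. \<omega>) \<in> measurable ?F (history_algebra M y j)"
        unfolding history_algebra_def by (intro measurable_vimage_algebra2) auto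
      from measurable_compose[OF this input]
      have [measurable]: "u j \<in> borel_measurable ?F" .
      show ?thesis
        unfolding Suc
        by (subst measurable_cong[OF filter_step]) auto
    qed
  qed
  have sub: "sets (rv_algebra M (xh k)) \<subseteq> sets (E.innovation_algebra k)" for k
    using estimate by (rule sets_rv_algebra_subset) simp_all
  have "sets (E.innovation_algebra k) \<subseteq> events" for k
    unfolding E.sets_innovation_algebra
    by (rule sets.sigma_sets_subset) (auto intro!: E.rectangle_events)
  then have "subalgebra M (rv_algebra M (xh k))" for k
    using sub[of k] by (auto simp: subalgebra_def rv_algebra_def)
  then show ?thesis
    using E.error_conditional_moments[OF _ sub] unfolding e_def[abs_def] by blast
qed

end
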